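(* Let $\mathfrak g$ be a split real form of a complex simple Lie algebra, with a positive root system $\Delta^+$ and simple roots $\Pi$. Let $\Pi_0\subset\Pi$ with $|\Pi_0|\ge 2$, let $\mathfrak n$ be the nilradical of the parabolic subalgebra associated with $\Pi_0$, and let $k$ be its nilpotency step. Let $\gamma\in\Delta_{\mathfrak n}^+$ be such that $X_\gamma\in\mathrm C^{k-1}(\mathfrak n)$. Then for any $\alpha\in\Pi_0$ there exist some $t\ge1$ and roots $\delta,\beta_1,\ldots,\beta_t\in\Delta_{\mathfrak n}^+$ such that $$\gamma=\delta+\beta_t+\beta_{t-1}+\cdots+\beta_1,$$ $\operatorname{coord}_\alpha(\delta)=0$, $\operatorname{coord}_\alpha(\beta_j)\neq0$ for all $j=1,\ldots,t$, and every partial sum $\delta+\beta_t+\beta_{t-1}+\cdots+\beta_{t-s}$, $s=0,\ldots,t-1$, is a root in $\Delta_{\mathfrak n}^+$.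
   Context: Let $\mathfrak g=\mathfrak g^-+\mathfrak h+\mathfrak g^+$ be the triangular decomposition associated with $\Delta^+$. For $\gamma\in\Delta^+$, $\mathfrak g_\gamma$ is the root space, $X_\gamma$ denotes an arbitrary nonzero root vector in $\mathfrak g_\gamma$, and for $\alpha\in\Pi$, $\operatorname{coord}_\alpha(\gamma)$ is the coefficient of $\alpha$ when $\gamma$ is written as a linear combination of simple roots. The parabolic subalgebras containing the Borel subalgebra $\mathfrak h+\mathfrak g^+$ are parametrized by subsets $\Pi_0\subset\Pi$; the nilradical of the one associated with $\Pi_0$ is $$\mathfrak n=\bigoplus_{\gamma\in\Delta_{\mathfrak n}^+}\mathfrak g_\gamma,\qquad \Delta_{\mathfrak n}^+=\{\gamma\in\Delta^+:\operatorname{coord}_\alpha(\gamma)\neq 0\text{ for some }\alpha\in\Pi_0\}.$$ The lower central series of $\mathfrak n$ is $\mathrm C^0(\mathfrak n)=\mathfrak n$, $\mathrm C^j(\mathfrak n)=[\mathfrak n,\mathrm C^{j-1}(\mathfrak n)]$ for $j\ge1$; $\mathfrak n$ is $k$-step nilpotent, meaning $\mathrm C^{k}(\mathfrak n)=0$ and $\mathrm C^{k-1}(\mathfrak n)\neq0$. *)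

theory Defs
  imports Complex_Main "HOL-Library.Function_Algebras" "HOL-Library.Product_Plus"
begin

section \<open>Lie algebras over a field\<close>

locale lie_algebra = vector_space scale
  for scale :: "'k::field \<Rightarrow> 'g::ab_group_add \<Rightarrow> 'g" (infixr "*s" 75) +
  fixes bracket :: "'g \<Rightarrow> 'g \<Rightarrow> 'g"
  assumes linear_right: "Vector_Spaces.linear (*s) (*s) (\<lambda>y. bracket x y)"
    and linear_left: "Vector_Spaces.linear (*s) (*s) (\<lambda>x. bracket x y)"
    and alternating: "bracket x x = 0"
    and jacobi: "bracket x (bracket y z) + bracket y (bracket z x) + bracket z (bracket x y) = 0"
begin

definition finite_dimensional :: bool where
  "finite_dimensional \<longleftrightarrow> (\<exists>B. finite B \<and> span B = UNIV)"

definition lie_subalgebra :: "'g set \<Rightarrow> bool" where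
  "lie_subalgebra S \<longleftrightarrow> subspace S \<and> (\<forall>x\<in>S. \<forall>y\<in>S. bracket x y \<in> S)"

definition lie_ideal :: "'g set \<Rightarrow> bool" where
  "lie_ideal I \<longleftrightarrow> subspace I \<and> (\<forall>x. \<forall>y\<in>I. bracket x y \<in> I)"

definition simple :: bool where
  "simple \<longleftrightarrow> (\<exists>x y. bracket x y \<noteq> 0) \<and> (\<forall>I. lie_ideal I \<longrightarrow> I = {0} \<or> I = UNIV)"

definition bracket_span :: "'g set \<Rightarrow> 'g set \<Rightarrow> 'g set" where
  "bracket_span A B = span {bracket x y | x y. x \<in> A \<and> y \<in> B}"

primrec lower_central :: "'g set \<Rightarrow> nat \<Rightarrow> 'g set" where
  "lower_central N 0 = N"
| "lower_central N (Suc j) = bracket_span N (lower_central N j)"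

definition nilpotent :: "'g set \<Rightarrow> bool" where
  "nilpotent N \<longleftrightarrow> (\<exists>k. lower_central N k = {0})"

definition step_nilpotent :: "nat \<Rightarrow> 'g set \<Rightarrow> bool" where
  "step_nilpotent k N \<longleftrightarrow>
     k \<ge> 1 \<and> lower_central N k = {0} \<and> lower_central N (k - 1) \<noteq> {0}"

definition normalizer :: "'g set \<Rightarrow> 'g set" where
  "normalizer S = {x. \<forall>y\<in>S. bracket x y \<in> S}"

definition cartan_subalgebra :: "'g set \<Rightarrow> bool" where
  "cartan_subalgebra h \<longleftrightarrow> lie_subalgebra h \<and> nilpotent h \<and> normalizer h = h"

text \<open>A Cartan subalgebra is split if the adjoint action of each of its elements is
  diagonalizable over the ground field.\<close>

definition split_cartan :: "'g set \<Rightarrow> bool" where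
  "split_cartan h \<longleftrightarrow>
     cartan_subalgebra h \<and> (\<forall>H\<in>h. span (\<Union>c. {x. bracket H x = c *s x}) = UNIV)"

definition root_space :: "'g set \<Rightarrow> ('g \<Rightarrow> 'k) \<Rightarrow> 'g set" where
  "root_space h \<alpha> = {x. \<forall>H\<in>h. bracket H x = \<alpha> H *s x}"

text \<open>A functional on \<open>h\<close> is encoded by the function on the whole algebra that agrees with it
  on \<open>h\<close> and is \<open>0\<close> outside \<open>h\<close>. Each functional thus has exactly one encoding, and the vector
  space operations on functionals are the pointwise ones on functions.\<close>

definition dual_of :: "'g set \<Rightarrow> ('g \<Rightarrow> 'k) set" where
  "dual_of h = {\<alpha>. (\<forall>x\<in>h. \<forall>y\<in>h. \<alpha> (x + y) = \<alpha> x + \<alpha> y) \<and>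
                   (\<forall>c. \<forall>x\<in>h. \<alpha> (c *s x) = c * \<alpha> x) \<and>
                   (\<forall>x. x \<notin> h \<longrightarrow> \<alpha> x = 0)}"

definition roots :: "'g set \<Rightarrow> ('g \<Rightarrow> 'k) set" where
  "roots h = {\<alpha> \<in> dual_of h. \<alpha> \<noteq> 0 \<and> root_space h \<alpha> \<noteq> {0}}"

end

section \<open>Positive systems and coordinates\<close>

definition positive_system :: "'a::group_add set \<Rightarrow> 'a set \<Rightarrow> bool" where
  "positive_system R P \<longleftrightarrow>
     P \<subseteq> R \<and>
     (\<forall>\<alpha>\<in>R. (\<alpha> \<in> P) \<noteq> (- \<alpha> \<in> P)) \<and>
     (\<forall>\<alpha>\<in>P. \<forall>\<beta>\<in>P. \<alpha> + \<beta> \<in> R \<longrightarrow> \<alpha> + \<beta> \<in> P)"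

definition simple_roots :: "'a::plus set \<Rightarrow> 'a set" where
  "simple_roots P = {\<alpha> \<in> P. \<not> (\<exists>\<beta>\<in>P. \<exists>\<gamma>\<in>P. \<alpha> = \<beta> + \<gamma>)}"

definition scale_fun :: "'k::field \<Rightarrow> ('g \<Rightarrow> 'k) \<Rightarrow> 'g \<Rightarrow> 'k" where
  "scale_fun c f = (\<lambda>x. c * f x)"

lemma vector_space_scale_fun: "vector_space scale_fun"
  by unfold_locales (auto simp: scale_fun_def fun_eq_iff algebra_simps)

definition coord :: "('g \<Rightarrow> 'k::field) set \<Rightarrow> ('g \<Rightarrow> 'k) \<Rightarrow> ('g \<Rightarrow> 'k) \<Rightarrow> 'k" where
  "coord P \<alpha> \<gamma> = module.representation scale_fun (simple_roots P) \<gamma> \<alpha>"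

text \<open>The roots occurring in the nilradical of the parabolic subalgebra given by
  \<open>\<Pi>0 \<subseteq> simple_roots P\<close>: the simple roots in \<open>\<Pi>0\<close> are those \<^emph>\<open>not\<close> in the Levi factor.\<close>

definition nilradical_roots :: "('g \<Rightarrow> 'k::field) set \<Rightarrow> ('g \<Rightarrow> 'k) set \<Rightarrow> ('g \<Rightarrow> 'k) set" where
  "nilradical_roots P \<Pi>0 = {\<gamma> \<in> P. \<exists>\<alpha>\<in>\<Pi>0. coord P \<alpha> \<gamma> \<noteq> 0}"

definition (in lie_algebra) parabolic_nilradical ::
    "'g set \<Rightarrow> ('g \<Rightarrow> 'k) set \<Rightarrow> ('g \<Rightarrow> 'k) set \<Rightarrow> 'g set" where
  "parabolic_nilradical h P \<Pi>0 = span (\<Union>\<gamma>\<in>nilradical_roots P \<Pi>0. root_space h \<gamma>)"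

section \<open>Complexification and split real forms\<close>

text \<open>The pair \<open>(x, y)\<close> stands for \<open>x + \<i> y\<close>.\<close>

definition complex_scale :: "complex \<Rightarrow> 'g \<times> 'g \<Rightarrow> 'g::real_vector \<times> 'g" where
  "complex_scale c = (\<lambda>(x, y). (Re c *\<^sub>R x - Im c *\<^sub>R y, Re c *\<^sub>R y + Im c *\<^sub>R x))"

definition complex_bracket ::
    "('g \<Rightarrow> 'g \<Rightarrow> 'g) \<Rightarrow> 'g \<times> 'g \<Rightarrow> 'g \<times> 'g \<Rightarrow> 'g::real_vector \<times> 'g" where
  "complex_bracket br =
     (\<lambda>(x, y) (x', y'). (br x x' - br y y', br x y' + br y x'))"

lemma lie_algebra_complexification:
  fixes br :: "'g::real_vector \<Rightarrow> 'g \<Rightarrow> 'g"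
  assumes "lie_algebra scaleR br"
  shows "lie_algebra complex_scale (complex_bracket br)"
proof -
  interpret L: lie_algebra scaleR br by fact
  have add: "br (x + y) z = br x z + br y z" "br z (x + y) = br z x + br z y" for x y z
    using L.linear_left[of z] L.linear_right[of z]
    by (simp_all add: Vector_Spaces.linear_iff)
  have diff: "br (x - y) z = br x z - br y z" "br z (x - y) = br z x - br z y" for x y z
    using add(1)[of "x - y" y z] add(2)[of z "x - y" y] by (simp_all add: algebra_simps)
  have sc: "br (c *\<^sub>R x) z = c *\<^sub>R br x z" "br z (c *\<^sub>R x) = c *\<^sub>R br z x" for c x z
    using L.linear_left[of z] L.linear_right[of z]
    by (simp_all add: Vector_Spaces.linear_iff)
  have anti: "br x y = - br y x" for x y
    using L.alternating[of "x + y"] L.alternating[of x] L.alternating[of y]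
    by (simp add: add eq_neg_iff_add_eq_0 add.commute)
  have vs: "vector_space (complex_scale :: complex \<Rightarrow> 'g \<times> 'g \<Rightarrow> _)"
    by unfold_locales (auto simp: complex_scale_def algebra_simps)
  have jac: "br x (br y z) = - br y (br z x) - br z (br x y)" for x y z
    using L.jacobi[of x y z] by (simp add: algebra_simps eq_neg_iff_add_eq_0)
  show ?thesis
  proof (intro lie_algebra.intro vs lie_algebra_axioms.intro)
    fix x y z :: "'g \<times> 'g"
    obtain x1 x2 y1 y2 z1 z2 where [simp]: "x = (x1, x2)" "y = (y1, y2)" "z = (z1, z2)"
      by (cases x, cases y, cases z)
    show "Vector_Spaces.linear complex_scale complex_scale (\<lambda>y. complex_bracket br x y)"
      using vs by (auto simp: Vector_Spaces.linear_iff complex_scale_def complex_bracket_def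
          add diff sc algebra_simps)
    show "Vector_Spaces.linear complex_scale complex_scale (\<lambda>x. complex_bracket br x y)"
      using vs by (auto simp: Vector_Spaces.linear_iff complex_scale_def complex_bracket_def
          add diff sc algebra_simps)
    show "complex_bracket br x x = 0"
      using anti[of x1 x2] by (simp add: complex_bracket_def L.alternating zero_prod_def)
    show "complex_bracket br x (complex_bracket br y z) +
          complex_bracket br y (complex_bracket br z x) +
          complex_bracket br z (complex_bracket br x y) = 0"
      by (simp add: complex_bracket_def zero_prod_def add diff
          jac[of x1 y1 z1] jac[of x1 y2 z2] jac[of x2 y1 z2] jac[of x2 y2 z1]
          jac[of x1 y1 z2] jac[of x1 y2 z1] jac[of x2 y1 z1] jac[of x2 y2 z2])
  qed
qed

definition split_real_form :: "('g::real_vector \<Rightarrow> 'g \<Rightarrow> 'g) \<Rightarrow> 'g set \<Rightarrow> bool" where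
  "split_real_form br h \<longleftrightarrow>
     lie_algebra scaleR br \<and>
     lie_algebra.finite_dimensional (scaleR :: real \<Rightarrow> 'g \<Rightarrow> 'g) \<and>
     lie_algebra.simple complex_scale (complex_bracket br) \<and>
     lie_algebra.split_cartan scaleR br h"

end

theory Submission
  imports Defs
begin

text \<open>Over an ordered field the Killing form of a split simple Lie algebra is positive on the
  Cartan subalgebra \<open>h\<close>, since all weights of \<open>h\<close> take values in the field. This yields root
  vectors \<open>e\<close>, \<open>f\<close> spanning \<open>sl(2)\<close>-triples, and hence: roots at an obtuse angle have a sum
  that is a root or zero.

  Since \<open>C\<^sup>k(n) = 0\<close>, the vector \<open>X\<close> is centralized by \<open>n\<close>. If \<open>coord\<^sub>\<alpha>(\<gamma>) = 0\<close>, then \<open>X\<close>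
  would lie in the centralizer of all root spaces with \<open>coord\<^sub>\<alpha> \<noteq> 0\<close>, which is an ideal, thus
  everything; this is impossible. So every \<open>\<alpha> \<in> \<Pi>\<^sub>0\<close> has nonzero coordinate in \<open>\<gamma>\<close>. Choose
  \<open>\<alpha>' \<noteq> \<alpha>\<close> in \<open>\<Pi>\<^sub>0\<close>. A positive root in which both \<open>\<alpha>\<close> and \<open>\<alpha>'\<close> occur is a sum of two positive
  roots in each of which at least one of them occurs: split off any positive root; if neither
  occurs in it, use induction on the rest and move it into one of the two summands. Splitting
  repeatedly the summand that contains both gives the required chain.\<close>

section \<open>Positive systems\<close>

text \<open>The form \<open>q\<close> is only assumed to be additive in its first argument and symmetric on \<open>R\<close>:
  for functionals on a Cartan subalgebra, \<open>q f \<beta>\<close> is the value of \<open>f\<close> at the vector dual to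
  \<open>\<beta>\<close>, which makes sense for all \<open>f\<close> but only for roots \<open>\<beta>\<close>.\<close>

locale positive_root_pairing =
  fixes R P :: "'a::ab_group_add set"
    and q :: "'a \<Rightarrow> 'a \<Rightarrow> 'k::linordered_field"
  assumes finite_R: "finite R"
    and uminus_R: "\<beta> \<in> R \<Longrightarrow> - \<beta> \<in> R"
    and q_add: "q (f + g) \<beta> = q f \<beta> + q g \<beta>"
    and q_sym: "\<beta> \<in> R \<Longrightarrow> \<gamma> \<in> R \<Longrightarrow> q \<beta> \<gamma> = q \<gamma> \<beta>"
    and q_pos: "\<beta> \<in> R \<Longrightarrow> q \<beta> \<beta> > 0"
    and obtuse: "\<beta> \<in> R \<Longrightarrow> \<gamma> \<in> R \<Longrightarrow> q \<gamma> \<beta> < 0 \<Longrightarrow> \<beta> + \<gamma> \<in> R \<or> \<beta> + \<gamma> = 0"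
    and positive: "positive_system R P"
begin

lemma q_zero: "q 0 \<beta> = 0"
  using q_add[of 0 0 \<beta>] by simp

lemma q_uminus: "q (- f) \<beta> = - q f \<beta>"
  using q_add[of f "- f" \<beta>] by (simp add: q_zero eq_neg_iff_add_eq_0 add.commute)

lemma P_subset: "\<beta> \<in> P \<Longrightarrow> \<beta> \<in> R"
  and P_total: "\<beta> \<in> R \<Longrightarrow> \<beta> \<in> P \<or> - \<beta> \<in> P"
  and P_uminus: "\<beta> \<in> P \<Longrightarrow> - \<beta> \<notin> P"
  and P_add: "\<beta> \<in> P \<Longrightarrow> \<gamma> \<in> P \<Longrightarrow> \<beta> + \<gamma> \<in> R \<Longrightarrow> \<beta> + \<gamma> \<in> P"
  using positive by (auto simp: positive_system_def)

lemma P_add_nonzero: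
  assumes "\<beta> \<in> P" "\<gamma> \<in> P"
  shows "\<beta> + \<gamma> \<noteq> 0"
  using assms P_uminus[of \<beta>] by (metis minus_unique)

lemma acute:
  assumes "\<beta> \<in> R" "\<gamma> \<in> R" "q \<beta> \<gamma> > 0"
  shows "\<beta> - \<gamma> \<in> R \<or> \<beta> = \<gamma>"
proof -
  \<comment> \<open>Additivity holds only in the first argument, so the sign passes through symmetry
    on \<open>R\<close>.\<close>
  have "q \<beta> (- \<gamma>) = - q \<beta> \<gamma>"
    using assms q_sym uminus_R q_uminus by metis
  then show ?thesis
    using obtuse[of "- \<gamma>" \<beta>] assms uminus_R by auto
qed

text \<open>If neither sum is a root, \<open>obtuse\<close> makes \<beta> pair nonnegatively with
  \<gamma>1 and \<gamma>2, hence with \<gamma>1 + \<gamma>2. Taking \<gamma>1 or \<gamma>2 away from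
  the whole root leaves one of the two missing sums, so \<open>acute\<close> makes the whole root
  pair nonpositively with \<gamma>1 + \<gamma>2. That pairing is also a nonnegative number plus a
  positive square.\<close>

lemma add_root_cases:
  assumes roots: "\<beta> \<in> R" "\<gamma>1 \<in> R" "\<gamma>2 \<in> R" "\<gamma>1 + \<gamma>2 \<in> R" "\<beta> + (\<gamma>1 + \<gamma>2) \<in> R"
    and nz: "\<beta> + \<gamma>1 \<noteq> 0" "\<beta> + \<gamma>2 \<noteq> 0"
  shows "\<beta> + \<gamma>1 \<in> R \<or> \<beta> + \<gamma>2 \<in> R"
proof (rule ccontr)
  assume neg: "\<not> ?thesis"
  define \<gamma>' \<gamma> where "\<gamma>' = \<gamma>1 + \<gamma>2" and "\<gamma> = \<beta> + \<gamma>'"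
  have R: "\<gamma>' \<in> R" "\<gamma> \<in> R"
    using roots by (auto simp: \<gamma>'_def \<gamma>_def)
  have "q \<gamma>1 \<beta> \<ge> 0" "q \<gamma>2 \<beta> \<ge> 0"
    using neg nz obtuse roots by (meson not_le)+
  then have 1: "q \<beta> \<gamma>' \<ge> 0"
    using q_sym[OF roots(1) R(1)] by (simp add: \<gamma>'_def q_add)
  have "\<gamma> - \<gamma>1 = \<beta> + \<gamma>2" "\<gamma> - \<gamma>2 = \<beta> + \<gamma>1"
    by (auto simp: \<gamma>_def \<gamma>'_def)
  then have "q \<gamma> \<gamma>1 \<le> 0" "q \<gamma> \<gamma>2 \<le> 0"
    using neg nz acute[OF R(2) roots(2)] acute[OF R(2) roots(3)] by (fastforce simp: not_le)+
  then have "q \<gamma>1 \<gamma> \<le> 0" "q \<gamma>2 \<gamma> \<le> 0"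
    using q_sym R roots by simp_all
  then have "q \<gamma>' \<gamma> \<le> 0"
    by (simp add: \<gamma>'_def q_add)
  moreover have "q \<gamma>' \<gamma> = q \<beta> \<gamma>' + q \<gamma>' \<gamma>'"
    using q_sym[OF R] q_add[of \<beta> \<gamma>' \<gamma>'] by (simp add: \<gamma>_def)
  ultimately show False
    using 1 q_pos[OF R(1)] by simp
qed

lemma q_sum_list: "q (sum_list xs) \<beta> = (\<Sum>x\<leftarrow>xs. q x \<beta>)"
  by (induction xs) (auto simp: q_zero q_add)

text \<open>Pairing a vanishing sum with one entry produces another entry at an obtuse angle to it.
  Their sum is a positive root by \<open>obtuse\<close>, so merging the two shortens the list
  without changing the sum.\<close>

lemma sum_list_positive_nonzero:
  assumes "xs \<noteq> []" "set xs \<subseteq> P"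
  shows "sum_list xs \<noteq> 0"
  using assms
proof (induction "length xs" arbitrary: xs rule: less_induct)
  case less
  obtain b ys where xs: "xs = b # ys"
    using less.prems by (cases xs) auto
  have b: "b \<in> P" and ys: "set ys \<subseteq> P"
    using less.prems xs by auto
  show ?case
  proof
    assume "sum_list xs = 0"
    then have "q b b + (\<Sum>x\<leftarrow>ys. q x b) = 0"
      using q_sum_list[of xs b] by (simp add: xs q_zero)
    then have "(\<Sum>x\<leftarrow>ys. q x b) < 0"
      using q_pos[OF P_subset[OF b]] by linarith
    then obtain x where x: "x \<in> set ys" "q x b < 0"
      using sum_list_nonneg[of "map (\<lambda>x. q x b) ys"] by (auto simp: not_le[symmetric])
    then have xb: "b + x \<in> P"
      using obtuse[of b x] P_add[of b x] P_add_nonzero[of b x] P_subset b ys by blast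
    define zs where "zs = (b + x) # remove1 x ys"
    have "sum_list ys = x + sum_list (remove1 x ys)"
      using sum_list_map_remove1[OF x(1), of "\<lambda>x. x"] by simp
    then have "sum_list zs = sum_list xs"
      by (simp add: zs_def xs algebra_simps)
    moreover have "length zs < length xs"
      using x(1) length_pos_if_in_set[OF x(1)] by (simp add: zs_def xs length_remove1)
    moreover have "set zs \<subseteq> P"
      using xb ys set_remove1_subset[of x ys] by (auto simp: zs_def)
    ultimately show False
      using less.hyps[of zs] \<open>sum_list xs = 0\<close> by (auto simp: zs_def)
  qed
qed

text \<open>Takes the place of induction on height, which would presuppose independent simple roots.
  The relation \<open>r\<close> is finite, and a cycle in it would give a nonempty list of positive
  roots with sum zero, so it is well-founded.\<close>

lemma positive_induct [consumes 1, case_names step]: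
  assumes "\<gamma> \<in> P"
    and step: "\<And>\<gamma>. \<gamma> \<in> P \<Longrightarrow> (\<And>\<beta>. \<beta> \<in> P \<Longrightarrow> \<gamma> - \<beta> \<in> P \<Longrightarrow> Q \<beta>) \<Longrightarrow> Q \<gamma>"
  shows "Q \<gamma>"
proof -
  define r where "r = {(\<beta>, \<gamma>). \<beta> \<in> P \<and> \<gamma> \<in> P \<and> \<gamma> - \<beta> \<in> P}"
  have "\<exists>xs. xs \<noteq> [] \<and> set xs \<subseteq> P \<and> \<gamma> - \<beta> = sum_list xs" if "(\<beta>, \<gamma>) \<in> r\<^sup>+" for \<beta> \<gamma>
    using that
  proof (induction rule: trancl_induct)
    case (base \<gamma>)
    then show ?case
      by (intro exI[of _ "[\<gamma> - \<beta>]"]) (auto simp: r_def)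
  next
    case (step \<gamma> \<gamma>')
    then obtain xs where "xs \<noteq> []" "set xs \<subseteq> P" "\<gamma> - \<beta> = sum_list xs"
      by blast
    moreover have "\<gamma>' - \<beta> = (\<gamma>' - \<gamma>) + (\<gamma> - \<beta>)"
      by simp
    ultimately show ?case
      using step(2) by (intro exI[of _ "(\<gamma>' - \<gamma>) # xs"]) (auto simp: r_def)
  qed
  then have "(\<gamma>, \<gamma>) \<notin> r\<^sup>+" for \<gamma>
    using sum_list_positive_nonzero by (metis diff_self)
  then have "acyclic r"
    by (simp add: acyclic_def)
  moreover have "finite r"
    by (rule finite_subset[of r "R \<times> R"]) (use P_subset finite_R in \<open>auto simp: r_def\<close>)
  ultimately have "wf r"
    by (rule finite_acyclic_wf[rotated])
  then show ?thesis
    using assms(1)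
  proof (induction \<gamma> rule: wf_induct_rule)
    case (less \<gamma>)
    then show ?case
      using step by (auto simp: r_def)
  qed
qed

lemma simple_or_sum:
  assumes "\<gamma> \<in> P"
  obtains "\<gamma> \<in> simple_roots P" | \<beta> \<gamma>' where "\<beta> \<in> P" "\<gamma>' \<in> P" "\<gamma> = \<beta> + \<gamma>'"
  using assms unfolding simple_roots_def by blast

section \<open>Splitting positive roots along two coordinates\<close>

context
  fixes a b :: "'a \<Rightarrow> 'k"
  assumes a_add: "\<And>\<beta> \<gamma>. \<beta> \<in> P \<Longrightarrow> \<gamma> \<in> P \<Longrightarrow> a (\<beta> + \<gamma>) = a \<beta> + a \<gamma>"
    and b_add: "\<And>\<beta> \<gamma>. \<beta> \<in> P \<Longrightarrow> \<gamma> \<in> P \<Longrightarrow> b (\<beta> + \<gamma>) = b \<beta> + b \<gamma>"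
    and a_nonneg: "\<And>\<beta>. \<beta> \<in> P \<Longrightarrow> a \<beta> \<ge> 0"
    and b_nonneg: "\<And>\<beta>. \<beta> \<in> P \<Longrightarrow> b \<beta> \<ge> 0"
    and simple: "\<And>\<sigma>. \<sigma> \<in> simple_roots P \<Longrightarrow> a \<sigma> = 0 \<or> b \<sigma> = 0"
begin

text \<open>Intended for \<open>a\<close> and \<open>b\<close> the coordinates at two simple roots.
  Such a \<gamma> is not simple, hence a sum of two positive roots, and only a summand on which both
  vanish needs repair.\<close>

lemma split_in_nilradical:
  assumes "\<gamma> \<in> P" "a \<gamma> \<noteq> 0" "b \<gamma> \<noteq> 0"
  shows "\<exists>\<gamma>1\<in>P. \<exists>\<gamma>2\<in>P. \<gamma> = \<gamma>1 + \<gamma>2 \<and> (a \<gamma>1 \<noteq> 0 \<or> b \<gamma>1 \<noteq> 0) \<and> (a \<gamma>2 \<noteq> 0 \<or> b \<gamma>2 \<noteq> 0)"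
  using assms
proof (induction \<gamma> rule: positive_induct)
  case (step \<gamma>)
  \<comment> \<open>A summand \<beta> invisible to \<open>a\<close> and \<open>b\<close> is
    absorbed: the rest splits by induction, and \<open>add_root_cases\<close> adds \<beta> to one of
    the two parts, whose \<open>a\<close> and \<open>b\<close> values stay the same.\<close>
  have levi: ?case if \<beta>: "\<beta> \<in> P" "a \<beta> = 0" "b \<beta> = 0" and \<gamma>': "\<gamma>' \<in> P" "\<gamma> = \<beta> + \<gamma>'" for \<beta> \<gamma>'
  proof -
    have "a \<gamma>' \<noteq> 0" "b \<gamma>' \<noteq> 0"
      using step.prems \<beta> \<gamma>' a_add b_add by auto
    moreover have "\<gamma> - \<gamma>' \<in> P"
      using \<beta> \<gamma>' by simp
    ultimately obtain \<gamma>1 \<gamma>2 where *: "\<gamma>1 \<in> P" "\<gamma>2 \<in> P" "\<gamma>' = \<gamma>1 + \<gamma>2"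
        "a \<gamma>1 \<noteq> 0 \<or> b \<gamma>1 \<noteq> 0" "a \<gamma>2 \<noteq> 0 \<or> b \<gamma>2 \<noteq> 0"
      using step.IH \<gamma>' by blast
    have ab: "a (\<beta> + \<gamma>1) = a \<gamma>1" "b (\<beta> + \<gamma>1) = b \<gamma>1" "a (\<beta> + \<gamma>2) = a \<gamma>2" "b (\<beta> + \<gamma>2) = b \<gamma>2"
      using a_add b_add \<beta> * by auto
    have "\<beta> + \<gamma>1 \<in> P \<or> \<beta> + \<gamma>2 \<in> P"
      using add_root_cases[of \<beta> \<gamma>1 \<gamma>2] * \<beta> \<gamma>' step.hyps P_subset P_add P_add_nonzero by metis
    then show ?thesis
    proof
      assume "\<beta> + \<gamma>1 \<in> P"
      then show ?thesis
        using * ab \<gamma>' by (intro bexI[of _ "\<beta> + \<gamma>1"] bexI[of _ \<gamma>2]) (auto simp: algebra_simps)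
    next
      assume "\<beta> + \<gamma>2 \<in> P"
      then show ?thesis
        using * ab \<gamma>' by (intro bexI[of _ \<gamma>1] bexI[of _ "\<beta> + \<gamma>2"]) (auto simp: algebra_simps)
    qed
  qed
  from step.hyps show ?case
  proof (cases rule: simple_or_sum)
    case 1
    then show ?thesis
      using simple step.prems by blast
  next
    case (2 \<beta> \<gamma>')
    then have "\<gamma> = \<gamma>' + \<beta>"
      by (simp add: add.commute)
    with 2 consider "a \<beta> = 0 \<and> b \<beta> = 0" | "a \<gamma>' = 0 \<and> b \<gamma>' = 0"
      | "(a \<beta> \<noteq> 0 \<or> b \<beta> \<noteq> 0) \<and> (a \<gamma>' \<noteq> 0 \<or> b \<gamma>' \<noteq> 0)"
      by blast
    then show ?thesis
    proof cases
      case 1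
      then show ?thesis
        using 2 by (intro levi[of \<beta> \<gamma>']) auto
    next
      case 2
      then show ?thesis
        using \<open>\<gamma> = \<gamma>' + \<beta>\<close> \<open>\<beta> \<in> P\<close> \<open>\<gamma>' \<in> P\<close> by (intro levi[of \<gamma>' \<beta>]) auto
    next
      case 3
      then show ?thesis
        using 2 by (intro bexI[of _ \<beta>] bexI[of _ \<gamma>'] conjI) auto
    qed
  qed
qed

text \<open>In a splitting of \<gamma>, a summand with \<open>a\<close> zero serves as \<delta>, the
  other being the only step. Otherwise the recursion enters a summand with \<open>b\<close> nonzero
  and adds the other one last. Keeping \<open>b\<close> nonzero on \<delta> and on the partial sums
  later places them in the nilradical.\<close>

lemma staircase:
  assumes "\<gamma> \<in> P" "a \<gamma> \<noteq> 0" "b \<gamma> \<noteq> 0"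
  shows "\<exists>(t::nat) \<delta> \<beta>. t \<ge> 1 \<and> \<delta> \<in> P \<and> a \<delta> = 0 \<and> b \<delta> \<noteq> 0 \<and>
           (\<forall>j\<in>{1..t}. \<beta> j \<in> P \<and> a (\<beta> j) \<noteq> 0) \<and> \<gamma> = \<delta> + (\<Sum>j\<in>{1..t}. \<beta> j) \<and>
           (\<forall>s\<in>{0..t - 1}. \<delta> + (\<Sum>j\<in>{t - s..t}. \<beta> j) \<in> P \<and> b (\<delta> + (\<Sum>j\<in>{t - s..t}. \<beta> j)) \<noteq> 0)"
  using assms
proof (induction \<gamma> rule: positive_induct)
  case (step \<gamma>)
  have zero: ?case if "\<gamma>1 \<in> P" "\<gamma>2 \<in> P" "\<gamma> = \<gamma>1 + \<gamma>2" "a \<gamma>1 = 0" "b \<gamma>1 \<noteq> 0" for \<gamma>1 \<gamma>2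
    using that step.prems step.hyps a_add
    by (intro exI[of _ "1::nat"] exI[of _ \<gamma>1] exI[of _ "\<lambda>_. \<gamma>2"]) auto
  have append: ?case if \<gamma>: "\<gamma>1 \<in> P" "\<gamma>2 \<in> P" "\<gamma> = \<gamma>1 + \<gamma>2" and a: "a \<gamma>1 \<noteq> 0" "a \<gamma>2 \<noteq> 0" "b \<gamma>1 \<noteq> 0"
    for \<gamma>1 \<gamma>2
  proof -
    have "\<gamma> - \<gamma>1 \<in> P"
      using \<gamma> by simp
    then obtain t :: nat and \<delta> \<beta> where t: "t \<ge> 1" and \<delta>: "\<delta> \<in> P" "a \<delta> = 0" "b \<delta> \<noteq> 0"
      and \<beta>: "\<forall>j\<in>{1..t}. \<beta> j \<in> P \<and> a (\<beta> j) \<noteq> 0" and \<gamma>1: "\<gamma>1 = \<delta> + (\<Sum>j\<in>{1..t}. \<beta> j)"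
      and ps: "\<forall>s\<in>{0..t - 1}. \<delta> + (\<Sum>j\<in>{t - s..t}. \<beta> j) \<in> P \<and> b (\<delta> + (\<Sum>j\<in>{t - s..t}. \<beta> j)) \<noteq> 0"
      using step.IH[of \<gamma>1] \<gamma> a by blast
    \<comment> \<open>Partial sums run from the top index down, so the root added last gets index 1
      and the earlier ones move up by one.\<close>
    define \<beta>' where "\<beta>' j = (if j = 1 then \<gamma>2 else \<beta> (j - 1))" for j
    have shift: "(\<Sum>j\<in>{Suc m..Suc t}. \<beta>' j) = (\<Sum>j\<in>{m..t}. \<beta> j)" if "m \<ge> 1" for m
      using that by (subst sum.shift_bounds_cl_Suc_ivl) (auto simp: \<beta>'_def intro!: sum.cong)
    have total: "\<gamma> = \<delta> + (\<Sum>j\<in>{1..Suc t}. \<beta>' j)"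
      using shift[of 1] \<gamma>1 \<gamma> by (subst sum.atLeast_Suc_atMost) (auto simp: \<beta>'_def algebra_simps)
    have "\<delta> + (\<Sum>j\<in>{Suc t - s..Suc t}. \<beta>' j) \<in> P \<and> b (\<delta> + (\<Sum>j\<in>{Suc t - s..Suc t}. \<beta>' j)) \<noteq> 0"
      if "s \<in> {0..Suc t - 1}" for s
    proof (cases "s = t")
      case True
      then show ?thesis
        using total step by simp
    next
      case False
      then have "s \<in> {0..t - 1}" "t - s \<ge> 1" "Suc t - s = Suc (t - s)"
        using that by auto
      then show ?thesis
        using shift[of "t - s"] ps by simp
    qed
    moreover have "\<beta>' j \<in> P \<and> a (\<beta>' j) \<noteq> 0" if "j \<in> {1..Suc t}" for j
    proof (cases "j = 1")
      case False
      then have "j - 1 \<in> {1..t}"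
        using that by auto
      then show ?thesis
        using \<beta> False by (simp add: \<beta>'_def)
    qed (use \<gamma> a in \<open>simp add: \<beta>'_def\<close>)
    ultimately show ?thesis
      using \<delta> total by (intro exI[of _ "Suc t"] exI[of _ \<delta>] exI[of _ \<beta>']) simp
  qed
  obtain \<gamma>1 \<gamma>2 where \<gamma>: "\<gamma>1 \<in> P" "\<gamma>2 \<in> P" "\<gamma> = \<gamma>1 + \<gamma>2" "\<gamma> = \<gamma>2 + \<gamma>1"
    and ab: "a \<gamma>1 \<noteq> 0 \<or> b \<gamma>1 \<noteq> 0" "a \<gamma>2 \<noteq> 0 \<or> b \<gamma>2 \<noteq> 0"
    using split_in_nilradical[OF step.hyps step.prems] by (metis add.commute)
  show ?case
  proof (cases "a \<gamma>1 = 0 \<or> a \<gamma>2 = 0")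
    case True
    then show ?thesis
      using zero \<gamma> ab by blast
  next
    case False
    moreover have "b \<gamma>1 \<noteq> 0 \<or> b \<gamma>2 \<noteq> 0"
      using \<gamma>(3) b_add[OF \<gamma>(1,2)] step.prems by auto
    ultimately show ?thesis
      using append \<gamma> by blast
  qed
qed

end

end

section \<open>Traces and joint eigenvectors\<close>

context lie_algebra
begin

definition trace :: "'g set \<Rightarrow> ('g \<Rightarrow> 'g) \<Rightarrow> 'k" where
  "trace B f = (\<Sum>b\<in>B. representation B (f b) b)"

lemma trace_mult_commute:
  assumes B: "finite B" "independent B" "span B = UNIV"
    and f: "Vector_Spaces.linear (*s) (*s) f" and g: "Vector_Spaces.linear (*s) (*s) g"
  shows "trace B (\<lambda>x. f (g x)) = trace B (\<lambda>x. g (f x))"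
proof -
  have rep: "representation B (f v) b = (\<Sum>c\<in>B. representation B v c * representation B (f c) b)"
    if f: "Vector_Spaces.linear (*s) (*s) f" for f v b
  proof -
    interpret f: Vector_Spaces.linear "(*s)" "(*s)" f by fact
    have "f v = f (\<Sum>c\<in>B. representation B v c *s c)"
      using B by (subst sum_representation_eq) auto
    also have "\<dots> = (\<Sum>c\<in>B. representation B v c *s f c)"
      by (simp add: f.sum f.scale)
    finally show ?thesis
      using B by (simp add: representation_sum representation_scale)
  qed
  have "trace B (\<lambda>x. f (g x)) =
      (\<Sum>b\<in>B. \<Sum>c\<in>B. representation B (g b) c * representation B (f c) b)"
    unfolding trace_def by (intro sum.cong refl rep[OF f])
  also have "\<dots> = (\<Sum>c\<in>B. \<Sum>b\<in>B. representation B (f c) b * representation B (g b) c)"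
    by (subst sum.swap) (simp add: mult.commute)
  also have "\<dots> = trace B (\<lambda>x. g (f x))"
    unfolding trace_def by (intro sum.cong refl rep[OF g, symmetric])
  finally show ?thesis .
qed

lemma trace_add:
  assumes "independent B" "span B = UNIV"
  shows "trace B (\<lambda>x. f x + g x) = trace B f + trace B g"
  using assms by (simp add: trace_def representation_add sum.distrib)

lemma trace_scale:
  assumes "independent B" "span B = UNIV"
  shows "trace B (\<lambda>x. c *s f x) = c * trace B f"
  using assms by (simp add: trace_def representation_scale sum_distrib_left)

lemma trace_diff:
  assumes "independent B" "span B = UNIV"
  shows "trace B (\<lambda>x. f x - g x) = trace B f - trace B g"
  using assms by (simp add: trace_def representation_diff sum_subtractf)

text \<open>The vectors are indexed by their own eigenvalue functions, so some may be zero. Applying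
  \<open>T H - \<beta> H\<close>, with \<open>H\<close> separating \<alpha> from \<beta>, removes
  the \<beta> term; induction then kills a nonzero multiple of the \<alpha> term.\<close>

lemma joint_eigenvectors_independent:
  fixes x :: "('h \<Rightarrow> 'k) \<Rightarrow> 'g"
  assumes "finite A"
    and lin: "\<And>H. H \<in> S \<Longrightarrow> Vector_Spaces.linear (*s) (*s) (T H)"
    and "\<And>\<alpha> H. \<alpha> \<in> A \<Longrightarrow> H \<in> S \<Longrightarrow> T H (x \<alpha>) = \<alpha> H *s x \<alpha>"
    and "\<And>\<alpha> \<beta>. \<alpha> \<in> A \<Longrightarrow> \<beta> \<in> A \<Longrightarrow> \<alpha> \<noteq> \<beta> \<Longrightarrow> \<exists>H\<in>S. \<alpha> H \<noteq> \<beta> H"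
    and "sum x A = 0" "\<alpha> \<in> A"
  shows "x \<alpha> = 0"
  using assms(1,3-)
proof (induction A arbitrary: x \<alpha> rule: finite_induct)
  case (insert \<beta> A)
  have sum: "x \<beta> + sum x A = 0"
    using insert by simp
  have zero: "x \<alpha> = 0" if \<alpha>: "\<alpha> \<in> A" for \<alpha>
  proof -
    obtain H where H: "H \<in> S" "\<alpha> H \<noteq> \<beta> H"
      using insert.prems(2)[of \<alpha> \<beta>] insert.hyps \<alpha> by auto
    interpret T: Vector_Spaces.linear "(*s)" "(*s)" "T H" using lin H by blast
    have "(\<Sum>\<alpha>\<in>A. (\<alpha> H - \<beta> H) *s x \<alpha>) = T H (sum x A) - \<beta> H *s sum x A"
      using insert.prems(1) H
      by (simp add: T.sum scale_left_diff_distrib sum_subtractf scale_sum_right)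
    also have "sum x A = - x \<beta>"
      using sum by (simp add: eq_neg_iff_add_eq_0 add.commute)
    finally have eq: "(\<Sum>\<alpha>\<in>A. (\<alpha> H - \<beta> H) *s x \<alpha>) = 0"
      using insert.prems(1) H by (simp add: T.neg)
    have "(\<alpha> H - \<beta> H) *s x \<alpha> = 0"
    proof (rule insert.IH[where x = "\<lambda>\<alpha>. (\<alpha> H - \<beta> H) *s x \<alpha>", OF _ _ eq \<alpha>])
      fix \<alpha> K
      assume "\<alpha> \<in> A" "K \<in> S"
      then interpret K: Vector_Spaces.linear "(*s)" "(*s)" "T K" using lin by blast
      show "T K ((\<alpha> H - \<beta> H) *s x \<alpha>) = \<alpha> K *s ((\<alpha> H - \<beta> H) *s x \<alpha>)"
        using insert.prems(1) \<open>\<alpha> \<in> A\<close> \<open>K \<in> S\<close> by (simp add: K.scale mult.commute)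
    qed (use insert.prems in blast)
    then show ?thesis
      using H by simp
  qed
  then show ?case
    using insert.prems sum by auto
qed simp

lemma span_Union_sum:
  assumes "v \<in> span (\<Union>i. E i)" and E: "\<And>i. subspace (E i)"
  shows "\<exists>C x. finite C \<and> (\<forall>i. x i \<in> E i) \<and> v = sum x C"
  using assms(1)
proof (induction rule: span_induct_alt)
  case base
  show ?case
    using E by (intro exI[of _ "{}"] exI[of _ "\<lambda>_. 0"]) (auto simp: subspace_0)
next
  case (step c y v)
  then obtain C x i where C: "finite C" "\<forall>i. x i \<in> E i" "v = sum x C" "y \<in> E i"
    by blast
  \<comment> \<open>\<open>x\<close> may be nonzero outside \<open>C\<close>, so it is cut off there
    before the new term enters at \<open>i\<close>.\<close>
  define x' where "x' j = (if j \<in> C then x j else 0) + (if j = i then c *s y else 0)" for j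
  have "\<forall>j. x' j \<in> E j"
    using C E by (auto simp: x'_def subspace_0 subspace_add subspace_scale)
  moreover have "finite (insert i C)"
    using C(1) by simp
  moreover have "c *s y + v = sum x' (insert i C)"
  proof -
    have "sum x' (insert i C) = sum (\<lambda>j. if j \<in> C then x j else 0) (insert i C) + c *s y"
      unfolding x'_def sum.distrib using C(1) by simp
    also have "sum (\<lambda>j. if j \<in> C then x j else 0) (insert i C) = sum x C"
      using C(1) by (intro sum.mono_neutral_cong_right) auto
    finally show ?thesis
      unfolding C(3) by (simp only: add.commute)
  qed
  ultimately have "finite (insert i C) \<and> (\<forall>i. x' i \<in> E i) \<and> c *s y + v = sum x' (insert i C)"
    by (intro conjI)
  then show ?case
    by (intro exI)
qed

section \<open>Weight spaces\<close>

lemma bracket_add_left: "bracket (x + y) z = bracket x z + bracket y z"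
  and bracket_add_right: "bracket z (x + y) = bracket z x + bracket z y"
  and bracket_scale_left: "bracket (c *s x) z = c *s bracket x z"
  and bracket_scale_right: "bracket z (c *s x) = c *s bracket z x"
  using linear_left[of z] linear_right[of z] by (simp_all add: Vector_Spaces.linear_iff)

lemma bracket_zero_left [simp]: "bracket 0 x = 0"
  and bracket_zero_right [simp]: "bracket x 0 = 0"
  using bracket_scale_left[of 0 0 x] bracket_scale_right[of x 0 0] by simp_all

lemma bracket_uminus_right: "bracket y (- x) = - bracket y x"
  using bracket_scale_right[of y "- 1" x] by simp

lemma bracket_diff_right: "bracket z (x - y) = bracket z x - bracket z y"
  using bracket_add_right[of z x "- y"] by (simp add: bracket_uminus_right)

lemma bracket_sum_right: "bracket z (sum f A) = (\<Sum>i\<in>A. bracket z (f i))"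
  by (induction A rule: infinite_finite_induct) (auto simp: bracket_add_right)

lemma bracket_anticommute: "bracket x y = - bracket y x"
  using alternating[of "x + y"] alternating[of x] alternating[of y]
  by (simp add: bracket_add_left bracket_add_right eq_neg_iff_add_eq_0 add.commute)

lemma bracket_derivation:
  "bracket x (bracket y z) = bracket (bracket x y) z + bracket y (bracket x z)"
proof -
  have "bracket y (bracket z x) = - bracket y (bracket x z)"
    by (subst bracket_anticommute[of z x]) (rule bracket_uminus_right)
  moreover have "bracket z (bracket x y) = - bracket (bracket x y) z"
    by (rule bracket_anticommute)
  ultimately show ?thesis
    using jacobi[of x y z] by (simp add: algebra_simps)
qed

lemma eigenvectors_independent:
  assumes f: "Vector_Spaces.linear (*s) (*s) f" and "finite C"
    and "\<And>c. c \<in> C \<Longrightarrow> f (x c) = c *s x c" and "sum x C = 0" "c \<in> C"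
  shows "x c = 0"
proof -
  \<comment> \<open>A single operator is a family over \<open>unit\<close>: each eigenvalue becomes
    a constant function.\<close>
  let ?A = "(\<lambda>c (_::unit). c) ` C"
  have "inj_on (\<lambda>c (_::unit). c) C"
    by (auto simp: inj_on_def dest: fun_cong)
  then have "(\<Sum>\<alpha>\<in>?A. x (\<alpha> ())) = 0"
    using assms by (simp add: sum.reindex)
  then show ?thesis
    using joint_eigenvectors_independent[of ?A "{()}" "\<lambda>_. f" "\<lambda>\<alpha>. x (\<alpha> ())" "\<lambda>_. c"] assms
    by auto
qed

lemma subspace_root_space: "subspace (root_space h \<alpha>)"
  by (auto simp: subspace_def root_space_def bracket_add_right bracket_scale_right
      scale_right_distrib mult.commute)

lemma bracket_root_space:
  assumes "x \<in> root_space h \<alpha>" "y \<in> root_space h \<beta>"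
  shows "bracket x y \<in> root_space h (\<alpha> + \<beta>)"
  using assms
  by (auto simp: root_space_def bracket_derivation[of _ x y] bracket_scale_left
      bracket_scale_right scale_left_distrib)

lemma dual_ofD:
  assumes "\<alpha> \<in> dual_of h"
  shows "x \<in> h \<Longrightarrow> y \<in> h \<Longrightarrow> \<alpha> (x + y) = \<alpha> x + \<alpha> y"
    and "x \<in> h \<Longrightarrow> \<alpha> (c *s x) = c * \<alpha> x" and "x \<notin> h \<Longrightarrow> \<alpha> x = 0"
  using assms by (auto simp: dual_of_def)

lemma dual_ofI:
  assumes "\<And>x y. x \<in> h \<Longrightarrow> y \<in> h \<Longrightarrow> \<alpha> (x + y) = \<alpha> x + \<alpha> y"
    and "\<And>c x. x \<in> h \<Longrightarrow> \<alpha> (c *s x) = c * \<alpha> x" and "\<And>x. x \<notin> h \<Longrightarrow> \<alpha> x = 0"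
  shows "\<alpha> \<in> dual_of h"
  using assms unfolding dual_of_def by blast

lemma dual_of_add:
  assumes "\<alpha> \<in> dual_of h" "\<beta> \<in> dual_of h"
  shows "\<alpha> + \<beta> \<in> dual_of h"
  by (rule dual_ofI) (simp_all add: dual_ofD[OF assms(1)] dual_ofD[OF assms(2)] distrib_left add_ac)

lemma dual_of_uminus:
  assumes "\<alpha> \<in> dual_of h"
  shows "- \<alpha> \<in> dual_of h"
  by (rule dual_ofI) (simp_all add: dual_ofD[OF assms])

lemma zero_dual_of: "0 \<in> dual_of h"
  by (rule dual_ofI) simp_all

lemma dual_of_neq:
  assumes "\<alpha> \<in> dual_of h" "\<beta> \<in> dual_of h" "\<alpha> \<noteq> \<beta>"
  shows "\<exists>H\<in>h. \<alpha> H \<noteq> \<beta> H"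
proof -
  obtain H where "\<alpha> H \<noteq> \<beta> H"
    using assms(3) by (auto simp: fun_eq_iff)
  moreover from this have "H \<in> h"
    using dual_ofD(3)[OF assms(1)] dual_ofD(3)[OF assms(2)] by metis
  ultimately show ?thesis
    by blast
qed

definition weights :: "'g set \<Rightarrow> ('g \<Rightarrow> 'k) set" where
  "weights h = {\<alpha> \<in> dual_of h. root_space h \<alpha> \<noteq> {0}}"

lemma roots_eq_weights: "roots h = weights h - {0}"
  by (auto simp: roots_def weights_def)

lemma weightsE:
  assumes "\<alpha> \<in> weights h"
  obtains x where "x \<in> root_space h \<alpha>" "x \<noteq> 0"
  using assms subspace_0[OF subspace_root_space[of h \<alpha>]] by (auto simp: weights_def)

lemma weightsI:
  assumes "\<alpha> \<in> dual_of h" "x \<in> root_space h \<alpha>" "x \<noteq> 0"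
  shows "\<alpha> \<in> weights h"
  using assms by (auto simp: weights_def)

lemma finite_weights:
  assumes finite_dimensional
  shows "finite (weights h)"
proof (rule ccontr)
  assume inf: "infinite (weights h)"
  obtain B where B: "finite B" "span B = UNIV"
    using assms by (auto simp: finite_dimensional_def)
  obtain A where A: "finite A" "A \<subseteq> weights h" "card A = Suc (card B)"
    using infinite_arbitrarily_large[OF inf] by blast
  have "\<forall>\<alpha>\<in>A. \<exists>x. x \<in> root_space h \<alpha> \<and> x \<noteq> 0"
    using weightsE A(2) by blast
  then obtain x where x: "\<And>\<alpha>. \<alpha> \<in> A \<Longrightarrow> x \<alpha> \<in> root_space h \<alpha> \<and> x \<alpha> \<noteq> 0"
    by metis
  have sep: "\<exists>H\<in>h. \<alpha> H \<noteq> \<beta> H" if "\<alpha> \<in> A" "\<beta> \<in> A" "\<alpha> \<noteq> \<beta>" for \<alpha> \<beta>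
    using that A(2) by (intro dual_of_neq) (auto simp: weights_def)
  have inj: "inj_on x A"
  proof (rule inj_onI, rule ccontr)
    fix \<alpha> \<beta>
    assume *: "\<alpha> \<in> A" "\<beta> \<in> A" "x \<alpha> = x \<beta>" "\<alpha> \<noteq> \<beta>"
    then obtain H where H: "H \<in> h" "\<alpha> H \<noteq> \<beta> H"
      using sep by blast
    have "\<alpha> H *s x \<alpha> = \<beta> H *s x \<alpha>"
      using x[of \<alpha>] x[of \<beta>] * H by (auto simp: root_space_def)
    then show False
      using H x * by auto
  qed
  have "independent (x ` A)"
  proof (rule independent_if_scalars_zero)
    fix f v
    assume sum: "(\<Sum>v\<in>x ` A. f v *s v) = 0" and "v \<in> x ` A"
    then obtain \<alpha> where \<alpha>: "\<alpha> \<in> A" "v = x \<alpha>"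
      by auto
    have "(\<Sum>\<alpha>\<in>A. f (x \<alpha>) *s x \<alpha>) = 0"
      using sum inj by (simp add: sum.reindex)
    then have "f (x \<alpha>) *s x \<alpha> = 0"
      by (intro joint_eigenvectors_independent[where S = h and T = bracket and A = A
            and x = "\<lambda>\<alpha>. f (x \<alpha>) *s x \<alpha>"])
         (use A \<alpha> linear_right sep x in
           \<open>auto simp: bracket_scale_right root_space_def mult.commute\<close>)
    then show "f v = 0"
      using \<alpha> x by auto
  qed (use A in simp)
  then have "card (x ` A) \<le> card B"
    using independent_span_bound[of B "x ` A"] B by auto
  then show False
    using A inj by (simp add: card_image)
qed

lemma diagonalizable_decomposition:
  assumes "span (\<Union>c. {x. bracket H x = c *s x}) = UNIV"
  shows "\<exists>C x. finite C \<and> (\<forall>c. bracket H (x c) = c *s x c) \<and> v = sum x C"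
proof -
  have "subspace {x. bracket H x = c *s x}" for c
    by (auto simp: subspace_def bracket_add_right bracket_scale_right scale_right_distrib mult.commute)
  then show ?thesis
    using span_Union_sum[of v "\<lambda>c. {x. bracket H x = c *s x}"] assms by auto
qed

text \<open>On an eigencomponent \<open>x c\<close> the power acts as \<open>c ^ m\<close>.
  Independence gives \<open>c ^ m *s x c = 0\<close>, whence \<open>c *s x c = 0\<close>, also for
  \<open>m = 0\<close>.\<close>

lemma diagonalizable_nilpotent:
  assumes diag: "span (\<Union>c. {x. bracket H x = c *s x}) = UNIV"
    and nil: "(bracket H ^^ m) v = 0"
  shows "bracket H v = 0"
proof -
  obtain C x where C: "finite C" "\<And>c. bracket H (x c) = c *s x c" "v = sum x C"
    using diagonalizable_decomposition[OF diag, of v] by blast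
  have "(bracket H ^^ m) v = (\<Sum>c\<in>C. c ^ m *s x c)"
  proof (induction m)
    case (Suc m)
    then show ?case
      by (simp add: C(2) bracket_sum_right bracket_scale_right power_Suc2 del: power_Suc)
  qed (simp add: C(3))
  then have sum: "(\<Sum>c\<in>C. c ^ m *s x c) = 0"
    using nil by simp
  have "c ^ m *s x c = 0" if "c \<in> C" for c
    by (rule eigenvectors_independent[OF linear_right[of H] C(1), where x = "\<lambda>c. c ^ m *s x c"])
       (simp_all add: C(2) sum that bracket_scale_right mult.commute)
  then have "(\<Sum>c\<in>C. c *s x c) = 0"
    by (intro sum.neutral) auto
  then show ?thesis
    by (simp add: C bracket_sum_right)
qed

text \<open>Nilpotency of \<open>h\<close> makes \<open>bracket H\<close> nilpotent on
  \<open>h\<close>; being diagonalizable, it vanishes there.\<close>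

lemma split_cartan_abelian:
  assumes "split_cartan h" "H \<in> h" "K \<in> h"
  shows "bracket H K = 0"
proof -
  obtain m where m: "lower_central h m = {0}"
    using assms by (auto simp: split_cartan_def cartan_subalgebra_def nilpotent_def)
  have "(bracket H ^^ n) K \<in> lower_central h n" for n
    using assms by (induction n) (auto simp: bracket_span_def intro!: span_base)
  then have "(bracket H ^^ m) K = 0"
    using m by blast
  then show ?thesis
    using diagonalizable_nilpotent assms by (auto simp: split_cartan_def)
qed

text \<open>Simultaneous diagonalization, one element of \<open>S\<close> at a time. Only the values
  of \<phi> on \<open>S\<close> matter, so \<phi> is updated at each new element.\<close>

lemma joint_eigenspaces_span:
  assumes "split_cartan h" "finite S" "S \<subseteq> h"
  shows "span (\<Union>\<phi>. root_space S \<phi>) = UNIV"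
  using assms(2,3)
proof (induction S)
  case empty
  have "(\<Union>\<phi>. root_space {} \<phi>) = UNIV"
    by (auto simp: root_space_def)
  then show ?case
    using span_superset by (metis top.extremum_uniqueI)
next
  case (insert H S)
  let ?V = "\<Union>\<phi>. root_space (insert H S) \<phi>"
  have diag: "span (\<Union>c. {x. bracket H x = c *s x}) = UNIV"
    using assms(1) insert.prems by (auto simp: split_cartan_def)
  have "x \<in> span ?V" if x: "x \<in> root_space S \<phi>" for x \<phi>
  proof -
    obtain C y where C: "finite C" "\<And>c. bracket H (y c) = c *s y c" "x = sum y C"
      using diagonalizable_decomposition[OF diag, of x] by blast
    have "bracket K (y c) = \<phi> K *s y c" if "c \<in> C" "K \<in> S" for c K
    proof -
      have HK: "bracket H K = 0"
        using split_cartan_abelian[OF assms(1)] that insert.prems by blast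
      \<comment> \<open>The defects \<open>?z c\<close> are eigenvectors of \<open>H\<close> for
        different \<open>c\<close> because \<open>H\<close> and \<open>K\<close> commute, and they
        add up to zero since \<open>x\<close> is an eigenvector of \<open>K\<close>.\<close>
      let ?z = "\<lambda>c. bracket K (y c) - \<phi> K *s y c"
      have "bracket H (?z c) = c *s ?z c" for c
        by (simp add: bracket_diff_right bracket_scale_right bracket_derivation[of H K] HK C(2)
            scale_right_diff_distrib mult.commute)
      moreover have "sum ?z C = 0"
        using x \<open>K \<in> S\<close>
        by (simp add: sum_subtractf C(3) root_space_def bracket_sum_right scale_sum_right)
      ultimately have "?z c = 0"
        using eigenvectors_independent[OF linear_right[of H] C(1), of ?z c] \<open>c \<in> C\<close> by blast
      then show ?thesis
        by simp
    qed
    then have "y c \<in> root_space (insert H S) (\<phi>(H := c))" if "c \<in> C" for c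
      using C(2) insert.hyps that by (auto simp: root_space_def)
    then show ?thesis
      unfolding C(3) by (blast intro: span_sum span_base)
  qed
  then have "span (\<Union>\<phi>. root_space S \<phi>) \<subseteq> span ?V"
    by (intro span_minimal) auto
  then show ?case
    using insert by auto
qed

lemma root_space_span:
  assumes x: "x \<in> root_space S \<phi>" and h: "span S = h"
  shows "\<exists>\<alpha>\<in>dual_of h. x \<in> root_space h \<alpha>"
proof (cases "x = 0")
  case True
  then show ?thesis
    using zero_dual_of subspace_0[OF subspace_root_space] by blast
next
  case False
  have "\<exists>c. bracket K x = c *s x" if "K \<in> span S" for K
    using that
  proof (induction rule: span_induct_alt)
    case base
    show ?case
      by (auto intro: exI[of _ 0])
  next
    case (step c H K)
    then show ?case
      using x by (auto simp: root_space_def bracket_add_left bracket_scale_left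
          scale_left_distrib[symmetric])
  qed
  then obtain c where c: "\<And>K. K \<in> h \<Longrightarrow> bracket K x = c K *s x"
    using h by metis
  \<comment> \<open>The eigenvalues are cut off outside \<open>h\<close> as the encoding demands;
    they are linear on \<open>h\<close> because \<open>x\<close> is nonzero.\<close>
  define \<alpha> where "\<alpha> K = (if K \<in> h then c K else 0)" for K
  have sub: "subspace h"
    using h subspace_span by blast
  have "c (H + K) *s x = (c H + c K) *s x" if "H \<in> h" "K \<in> h" for H K
    using c[of "H + K"] c[of H] c[of K] that sub
    by (simp add: subspace_add bracket_add_left scale_left_distrib)
  moreover have "c (r *s H) *s x = (r * c H) *s x" if "H \<in> h" for H r
    using c[of "r *s H"] c[of H] that sub
    by (auto simp: subspace_scale bracket_scale_left)
  ultimately have "\<alpha> \<in> dual_of h"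
    using False sub by (auto simp: dual_of_def \<alpha>_def subspace_add subspace_scale)
  moreover have "x \<in> root_space h \<alpha>"
    using c by (simp add: root_space_def \<alpha>_def)
  ultimately show ?thesis
    by blast
qed

lemma weight_spaces_span:
  assumes "split_cartan h" finite_dimensional
  shows "span (\<Union>\<alpha>\<in>dual_of h. root_space h \<alpha>) = UNIV"
proof -
  have sub: "subspace h"
    using assms by (auto simp: split_cartan_def cartan_subalgebra_def lie_subalgebra_def)
  obtain S where S: "S \<subseteq> h" "independent S" "h \<subseteq> span S"
    by (rule maximal_independent_subset)
  have "finite S"
    using S independent_span_bound assms(2) by (metis finite_dimensional_def subset_UNIV)
  moreover have "span S = h"
    using S sub span_minimal by blast
  ultimately have "span (\<Union>\<phi>. root_space S \<phi>) = UNIV"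
      "(\<Union>\<phi>. root_space S \<phi>) \<subseteq> (\<Union>\<alpha>\<in>dual_of h. root_space h \<alpha>)"
    using joint_eigenspaces_span[OF assms(1) _ S(1)] root_space_span by auto
  then show ?thesis
    using span_mono by blast
qed

end

section \<open>The Killing form\<close>

lemma sum_squares_zeroD:
  fixes f :: "'a \<Rightarrow> 'k::linordered_idom"
  assumes "finite A" "(\<Sum>a\<in>A. f a * f a) = 0" "a \<in> A"
  shows "f a = 0"
  using assms sum_nonneg_eq_0_iff[of A "\<lambda>a. f a * f a"] by auto

locale split_simple_lie_algebra = lie_algebra scale bracket
  for scale :: "'k::linordered_field \<Rightarrow> 'g::ab_group_add \<Rightarrow> 'g" (infixr "*s" 75)
    and bracket :: "'g \<Rightarrow> 'g \<Rightarrow> 'g" +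
  fixes h :: "'g set"
  assumes fin_dim: finite_dimensional and simple: simple and split: "split_cartan h"
begin

lemma weight_basis_ex:
  "\<exists>B. finite B \<and> independent B \<and> span B = UNIV \<and> B \<subseteq> (\<Union>\<alpha>\<in>dual_of h. root_space h \<alpha>)"
proof -
  let ?V = "\<Union>\<alpha>\<in>dual_of h. root_space h \<alpha>"
  obtain B where B: "B \<subseteq> ?V" "independent B" "?V \<subseteq> span B"
    by (rule maximal_independent_subset)
  have "span B = UNIV"
    using B(3) span_minimal[of ?V "span B"] weight_spaces_span[OF split fin_dim] subspace_span
    by blast
  moreover have "finite B"
    using B independent_span_bound fin_dim by (metis finite_dimensional_def subset_UNIV)
  ultimately show ?thesis
    using B by blast
qed

text \<open>All traces are taken in one fixed basis of weight vectors, in which every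
  \<open>bracket H\<close> with \<open>H\<close> in \<open>h\<close> is diagonal.\<close>

definition weight_basis :: "'g set" where
  "weight_basis = (SOME B. finite B \<and> independent B \<and> span B = UNIV \<and>
     B \<subseteq> (\<Union>\<alpha>\<in>dual_of h. root_space h \<alpha>))"

lemma weight_basis:
  "finite weight_basis" "independent weight_basis" "span weight_basis = UNIV"
  "weight_basis \<subseteq> (\<Union>\<alpha>\<in>dual_of h. root_space h \<alpha>)"
  using someI_ex[OF weight_basis_ex] by (simp_all add: weight_basis_def)

definition killing :: "'g \<Rightarrow> 'g \<Rightarrow> 'k" where
  "killing x y = trace weight_basis (\<lambda>z. bracket x (bracket y z))"

lemma killing_add_left: "killing (x + y) z = killing x z + killing y z"
  and killing_add_right: "killing z (x + y) = killing z x + killing z y"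
  and killing_scale_left: "killing (c *s x) z = c * killing x z"
  and killing_scale_right: "killing z (c *s x) = c * killing z x"
  using weight_basis
  by (simp_all add: killing_def bracket_add_left bracket_add_right bracket_scale_left
      bracket_scale_right trace_add trace_scale)

lemma killing_zero_left [simp]: "killing 0 x = 0"
  and killing_zero_right [simp]: "killing x 0 = 0"
  using killing_scale_left[of 0 0 x] killing_scale_right[of x 0 0] by simp_all

lemma killing_uminus_left: "killing (- x) y = - killing x y"
  and killing_uminus_right: "killing y (- x) = - killing y x"
  using killing_scale_left[of "- 1" x y] killing_scale_right[of y "- 1" x] by simp_all

lemma killing_diff_left: "killing (x - y) z = killing x z - killing y z"
  using killing_add_left[of x "- y" z] by (simp add: killing_uminus_left)

lemma killing_sym: "killing x y = killing y x"
  unfolding killing_def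
  by (rule trace_mult_commute[OF weight_basis(1-3) linear_right linear_right])

text \<open>With brackets expanded as commutators of adjoint operators, the two sides differ only in
  the traces of \<open>y x z\<close> and \<open>x z y\<close>, which agree by cyclicity.\<close>

lemma killing_invariant: "killing (bracket x y) z = killing x (bracket y z)"
proof -
  have lin: "Vector_Spaces.linear (*s) (*s) (\<lambda>w. bracket x (bracket z w))"
    by (simp add: Vector_Spaces.linear_iff vector_space_axioms bracket_add_right bracket_scale_right)
  have comm: "bracket (bracket u v) w = bracket u (bracket v w) - bracket v (bracket u w)" for u v w
    using bracket_derivation[of u v w] by simp
  have "trace weight_basis (\<lambda>w. bracket y (bracket x (bracket z w))) =
      trace weight_basis (\<lambda>w. bracket x (bracket z (bracket y w)))"
    by (rule trace_mult_commute[OF weight_basis(1-3) linear_right lin])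
  then show ?thesis
    by (simp add: killing_def comm bracket_diff_right trace_diff[OF weight_basis(2,3)])
qed

lemma cartan_subspace: "subspace h"
  using split by (auto simp: split_cartan_def cartan_subalgebra_def lie_subalgebra_def)

text \<open>What commutes with \<open>h\<close> normalizes \<open>h\<close>, and a Cartan subalgebra
  is its own normalizer. The other inclusion is commutativity of \<open>h\<close>.\<close>

lemma root_space_zero: "root_space h 0 = h"
proof
  have "bracket x H \<in> h" if "x \<in> root_space h 0" "H \<in> h" for x H
    using that bracket_anticommute[of x H] subspace_0[OF cartan_subspace]
    by (simp add: root_space_def)
  then have "root_space h 0 \<subseteq> normalizer h"
    by (auto simp: normalizer_def)
  then show "root_space h 0 \<subseteq> h"
    using split by (auto simp: split_cartan_def cartan_subalgebra_def)
  show "h \<subseteq> root_space h 0"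
    using split_cartan_abelian[OF split] by (auto simp: root_space_def)
qed

lemma weight_vector_induct [case_names weight zero add]:
  assumes "\<And>\<alpha> x. \<alpha> \<in> dual_of h \<Longrightarrow> x \<in> root_space h \<alpha> \<Longrightarrow> Q x"
    and "Q 0" and "\<And>x y. Q x \<Longrightarrow> Q y \<Longrightarrow> Q (x + y)"
  shows "Q x"
proof -
  have "x \<in> span (\<Union>\<alpha>\<in>dual_of h. root_space h \<alpha>)"
    using weight_spaces_span[OF split fin_dim] by blast
  then show ?thesis
  proof (induction rule: span_induct_alt)
    case (step c x y)
    then show ?case
      using assms subspace_scale[OF subspace_root_space] by blast
  qed (rule assms)
qed

lemma killing_cartan:
  "\<exists>wt. (\<forall>H\<in>h. \<forall>K\<in>h. killing H K = (\<Sum>b\<in>weight_basis. wt b H * wt b K)) \<and>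
     (\<forall>b\<in>weight_basis. \<forall>H\<in>h. bracket H b = wt b H *s b)"
proof -
  obtain wt where wt: "\<And>b. b \<in> weight_basis \<Longrightarrow> b \<in> root_space h (wt b)"
    using weight_basis(4) by (metis UN_E subsetD)
  have eig: "bracket H b = wt b H *s b" if "b \<in> weight_basis" "H \<in> h" for b H
    using wt that by (auto simp: root_space_def)
  have "killing H K = (\<Sum>b\<in>weight_basis. wt b H * wt b K)" if "H \<in> h" "K \<in> h" for H K
    using that weight_basis
    by (simp add: killing_def trace_def eig bracket_scale_right representation_scale
        representation_basis mult.commute)
  then show ?thesis
    using eig by blast
qed

text \<open>The radical is an ideal. Were it everything, each \<open>killing H H\<close> would be a
  vanishing sum of squares of weights, so the weight basis would commute with \<open>h\<close> and
  hence lie in \<open>h\<close>. The algebra would then equal \<open>h\<close> and be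
  abelian.\<close>

lemma killing_nondegenerate:
  assumes "x \<noteq> 0"
  obtains y where "killing x y \<noteq> 0"
proof -
  define I where "I = {x. \<forall>y. killing x y = 0}"
  have "bracket x y \<in> I" if "y \<in> I" for x y
  proof -
    have "killing (bracket x y) z = - killing y (bracket x z)" for z
      unfolding bracket_anticommute[of x y] killing_uminus_left killing_invariant ..
    then show ?thesis
      using that by (simp add: I_def)
  qed
  then have "lie_ideal I"
    by (simp add: lie_ideal_def subspace_def I_def killing_add_left killing_scale_left)
  then have "I = {0} \<or> I = UNIV"
    using simple by (auto simp: simple_def)
  moreover have "I \<noteq> UNIV"
  proof
    assume UNIV: "I = UNIV"
    obtain wt where wt: "\<And>H K. H \<in> h \<Longrightarrow> K \<in> h \<Longrightarrow> killing H K = (\<Sum>b\<in>weight_basis. wt b H * wt b K)"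
      "\<And>b H. b \<in> weight_basis \<Longrightarrow> H \<in> h \<Longrightarrow> bracket H b = wt b H *s b"
      using killing_cartan by blast
    have "bracket H b = 0" if "H \<in> h" "b \<in> weight_basis" for H b
    proof -
      have "killing H H = 0"
        using UNIV by (auto simp: I_def)
      then have "(\<Sum>b\<in>weight_basis. wt b H * wt b H) = 0"
        using wt that by simp
      then have "wt b H = 0"
        by (rule sum_squares_zeroD[OF weight_basis(1) _ that(2)])
      then show ?thesis
        using wt that by simp
    qed
    then have "weight_basis \<subseteq> h"
      using root_space_zero by (auto simp: root_space_def)
    then have "h = UNIV"
      using span_minimal[OF _ cartan_subspace] weight_basis(3) by blast
    then show False
      using split_cartan_abelian[OF split] simple by (auto simp: simple_def)
  qed
  ultimately show ?thesis
    using assms that by (auto simp: I_def)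
qed

lemma killing_orthogonal:
  assumes "x \<in> root_space h \<alpha>" "y \<in> root_space h \<beta>" "\<alpha> \<in> dual_of h" "\<beta> \<in> dual_of h" "\<beta> \<noteq> - \<alpha>"
  shows "killing x y = 0"
proof -
  obtain H where H: "H \<in> h" "\<beta> H \<noteq> (- \<alpha>) H"
    using dual_of_neq[OF assms(4) dual_of_uminus[OF assms(3)] assms(5)] by blast
  have "killing (bracket x H) y = killing x (bracket H y)"
    by (rule killing_invariant)
  then have "- \<alpha> H * killing x y = \<beta> H * killing x y"
    using assms(1,2) H bracket_anticommute[of x H]
    by (simp add: root_space_def killing_scale_left killing_scale_right killing_uminus_left)
  then have "(\<beta> H - (- \<alpha>) H) * killing x y = 0"
    by (simp add: algebra_simps)
  then show ?thesis
    using H by simp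
qed

lemma killing_pairing:
  assumes "x \<in> root_space h \<alpha>" "\<alpha> \<in> dual_of h" "x \<noteq> 0"
  obtains y where "y \<in> root_space h (- \<alpha>)" "killing x y = 1"
proof -
  have "\<exists>y\<in>root_space h (- \<alpha>). killing x y \<noteq> 0"
  proof (rule ccontr)
    assume "\<not> ?thesis"
    then have *: "killing x y = 0" if "y \<in> root_space h \<beta>" "\<beta> \<in> dual_of h" for y \<beta>
      using killing_orthogonal[OF assms(1) that(1)] assms that by blast
    have "killing x y = 0" for y
      by (induction y rule: weight_vector_induct) (auto simp: killing_add_right intro: *)
    then show False
      using killing_nondegenerate[OF assms(3)] by metis
  qed
  then obtain y where "y \<in> root_space h (- \<alpha>)" "killing x y \<noteq> 0"
    by blast
  then show ?thesis
    using that[of "inverse (killing x y) *s y"] subspace_scale[OF subspace_root_space]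
    by (simp add: killing_scale_right)
qed

section \<open>Roots and their dual vectors\<close>

lemma uminus_roots: "\<alpha> \<in> roots h \<Longrightarrow> - \<alpha> \<in> roots h"
proof -
  assume \<alpha>: "\<alpha> \<in> roots h"
  then have dual: "\<alpha> \<in> dual_of h"
    by (simp add: roots_def)
  obtain x where "x \<in> root_space h \<alpha>" "x \<noteq> 0"
    using \<alpha> weightsE by (auto simp: roots_eq_weights)
  then obtain y where y: "y \<in> root_space h (- \<alpha>)" "killing x y = 1"
    using killing_pairing dual by blast
  then have "y \<noteq> 0"
    by auto
  then show "- \<alpha> \<in> roots h"
    using \<alpha> y weightsI[OF dual_of_uminus[OF dual]] by (simp add: roots_eq_weights)
qed

text \<open>The vector usually written \<open>t_\<alpha>\<close>. Uniqueness is shown in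
  \<open>dual_vector_eq\<close>, existence for roots in \<open>dual_vector\<close>.\<close>

definition dual_vector :: "('g \<Rightarrow> 'k) \<Rightarrow> 'g" where
  "dual_vector \<alpha> = (THE t. t \<in> h \<and> (\<forall>K\<in>h. killing t K = \<alpha> K))"

lemma dual_vector_eq:
  assumes "t \<in> h" "\<And>K. K \<in> h \<Longrightarrow> killing t K = \<alpha> K"
  shows "dual_vector \<alpha> = t"
  unfolding dual_vector_def
proof (rule the_equality)
  fix t'
  assume t': "t' \<in> h \<and> (\<forall>K\<in>h. killing t' K = \<alpha> K)"
  \<comment> \<open>The difference has weight zero and is orthogonal to \<open>h\<close>, so nothing
    in \<open>root_space h 0\<close> could pair with it to 1.\<close>
  define d where "d = t' - t"
  have "d \<in> root_space h 0"
    using assms t' cartan_subspace unfolding d_def root_space_zero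
    by (blast intro: subspace_diff)
  moreover have "killing d K = 0" if "K \<in> h" for K
    using assms t' that by (simp add: d_def killing_diff_left)
  ultimately have "d = 0"
    using killing_pairing[of d 0] zero_dual_of by (metis neg_0_equal_iff_equal root_space_zero zero_neq_one)
  then show "t' = t"
    by (simp add: d_def)
qed (use assms in blast)

text \<open>By invariance \<open>bracket e f\<close> pairs with \<open>K\<close> as \<open>e\<close>
  does with \<open>bracket f K\<close>, which is \<open>\<alpha> K *s f\<close>. This supplies the
  dual vector of a root.\<close>

lemma bracket_dual_vector:
  assumes "e \<in> root_space h \<alpha>" "f \<in> root_space h (- \<alpha>)" "killing e f = 1"
  shows "bracket e f \<in> h" "\<And>K. K \<in> h \<Longrightarrow> killing (bracket e f) K = \<alpha> K"
    "bracket e f = dual_vector \<alpha>"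
proof -
  show h: "bracket e f \<in> h"
    using bracket_root_space[OF assms(1,2)] root_space_zero by simp
  show k: "killing (bracket e f) K = \<alpha> K" if "K \<in> h" for K
    using assms that bracket_anticommute[of f K]
    by (simp add: killing_invariant root_space_def killing_scale_right killing_uminus_right)
  show "bracket e f = dual_vector \<alpha>"
    using dual_vector_eq[OF h k] by simp
qed

lemma dual_vector:
  assumes "\<alpha> \<in> roots h"
  shows "dual_vector \<alpha> \<in> h" "\<And>K. K \<in> h \<Longrightarrow> killing (dual_vector \<alpha>) K = \<alpha> K"
proof -
  obtain e where e: "e \<in> root_space h \<alpha>" "e \<noteq> 0"
    using assms weightsE by (auto simp: roots_eq_weights)
  obtain f where "f \<in> root_space h (- \<alpha>)" "killing e f = 1"
    using killing_pairing[OF e(1) _ e(2)] assms by (auto simp: roots_def)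
  then show "dual_vector \<alpha> \<in> h" "\<And>K. K \<in> h \<Longrightarrow> killing (dual_vector \<alpha>) K = \<alpha> K"
    using bracket_dual_vector[OF e(1)] by auto
qed

lemma dual_vector_sym:
  assumes "\<alpha> \<in> roots h" "\<beta> \<in> roots h"
  shows "\<alpha> (dual_vector \<beta>) = \<beta> (dual_vector \<alpha>)"
  using assms dual_vector killing_sym by metis

text \<open>For the dual vector \<open>t\<close>, \<open>\<alpha> t = killing t t\<close> is the sum
  of the squares of \<open>wt b t\<close>. If it vanished, every \<open>wt b t\<close> would be
  zero, so \<open>t\<close> would be orthogonal to \<open>h\<close> and \<alpha> would be
  zero.\<close>

lemma dual_vector_pos:
  assumes \<alpha>: "\<alpha> \<in> roots h"
  shows "\<alpha> (dual_vector \<alpha>) > 0"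
proof -
  define t where "t = dual_vector \<alpha>"
  have t: "t \<in> h" "\<And>K. K \<in> h \<Longrightarrow> killing t K = \<alpha> K"
    using dual_vector[OF \<alpha>] by (auto simp: t_def)
  obtain wt where wt: "\<And>H K. H \<in> h \<Longrightarrow> K \<in> h \<Longrightarrow> killing H K = (\<Sum>b\<in>weight_basis. wt b H * wt b K)"
    using killing_cartan by blast
  have eq: "\<alpha> t = (\<Sum>b\<in>weight_basis. wt b t * wt b t)"
    using t wt by metis
  have "\<alpha> t \<noteq> 0"
  proof
    assume "\<alpha> t = 0"
    then have "wt b t = 0" if "b \<in> weight_basis" for b
      using sum_squares_zeroD[OF weight_basis(1) _ that, of "\<lambda>b. wt b t"] eq by simp
    then have "\<alpha> K = 0" if "K \<in> h" for K
      using t wt[OF t(1) that] that by simp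
    then have "\<alpha> x = 0" for x
      using \<alpha> dual_ofD(3)[of \<alpha> h x] by (cases "x \<in> h") (auto simp: roots_def)
    then have "\<alpha> = 0"
      by (simp add: fun_eq_iff)
    then show False
      using \<alpha> by (simp add: roots_def)
  qed
  moreover have "\<alpha> t \<ge> 0"
    unfolding eq by (intro sum_nonneg) simp
  ultimately show ?thesis
    by (simp add: t_def)
qed

text \<open>If \<open>e x = 0\<close> then \<open>x\<close> is a highest weight vector of negative weight for the
  \<open>sl(2)\<close>-triple through \<open>e\<close>, and \<open>f\<close> generates an infinite string of weights from it.\<close>

lemma bracket_nonzero:
  assumes \<beta>: "\<beta> \<in> roots h" and e: "e \<in> root_space h \<beta>" "e \<noteq> 0"
    and \<gamma>: "\<gamma> \<in> dual_of h" and x: "x \<in> root_space h \<gamma>" "x \<noteq> 0"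
    and neg: "\<gamma> (dual_vector \<beta>) < 0"
  shows "bracket e x \<noteq> 0"
proof
  assume ex: "bracket e x = 0"
  have dual: "\<beta> \<in> dual_of h"
    using \<beta> by (simp add: roots_def)
  define t where "t = dual_vector \<beta>"
  obtain f where f: "f \<in> root_space h (- \<beta>)" "killing e f = 1"
    using killing_pairing[OF e(1) dual e(2)] .
  have t: "bracket e f = t" "t \<in> h"
    using bracket_dual_vector[OF e(1) f] by (auto simp: t_def)
  have \<beta>t: "\<beta> t > 0" and \<gamma>t: "\<gamma> t < 0"
    using dual_vector_pos[OF \<beta>] neg by (auto simp: t_def)
  define y where "y k = (bracket f ^^ k) x" for k
  define wt where "wt k = (\<lambda>H. \<gamma> H - of_nat k * \<beta> H)" for k :: nat
  have y_Suc: "y (Suc k) = bracket f (y k)" and y_0: "y 0 = x" for k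
    by (auto simp: y_def)
  have wt_Suc: "wt (Suc k) = - \<beta> + wt k" for k
    by (auto simp: wt_def fun_eq_iff algebra_simps)
  have y_wt: "y k \<in> root_space h (wt k)" for k
  proof (induction k)
    case 0
    then show ?case
      using x by (simp add: y_0 wt_def)
  next
    case (Suc k)
    then show ?case
      unfolding y_Suc wt_Suc by (rule bracket_root_space[OF f(1)])
  qed
  have ef: "bracket e (y (Suc k)) = wt k t *s y k + bracket f (bracket e (y k))" for k
    using y_wt[of k] t(2) by (simp add: y_Suc bracket_derivation[of e f] t(1) root_space_def)
  have wt_neg: "wt k t < 0" for k
  proof -
    have "of_nat k * \<beta> t \<ge> 0"
      using \<beta>t by simp
    then show ?thesis
      unfolding wt_def using \<gamma>t by linarith
  qed
  \<comment> \<open>The factor is the sum of \<open>wt 0 t\<close> up to \<open>wt k t\<close>, all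
    negative, so \<open>e\<close> undoes each \<open>f\<close> up to a nonzero scalar and no
    \<open>y k\<close> vanishes.\<close>
  have e_y: "\<exists>a<0. bracket e (y (Suc k)) = a *s y k" for k
  proof (induction k)
    case 0
    then show ?case
      using ef[of 0] wt_neg[of 0] ex by (auto simp: y_0)
  next
    case (Suc k)
    then obtain a where a: "a < 0" "bracket e (y (Suc k)) = a *s y k"
      by blast
    then have "bracket e (y (Suc (Suc k))) = (wt (Suc k) t + a) *s y (Suc k)"
      using ef[of "Suc k"] by (simp add: bracket_scale_right scale_left_distrib y_Suc[of k])
    then show ?case
      using a(1) wt_neg[of "Suc k"] by (meson add_neg_neg)
  qed
  have "y k \<noteq> 0" for k
  proof (induction k)
    case (Suc k)
    obtain a where "a < 0" "bracket e (y (Suc k)) = a *s y k"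
      using e_y by blast
    then show ?case
      using Suc by auto
  qed (use x in \<open>simp add: y_0\<close>)
  moreover have "wt k \<in> dual_of h" for k
    using \<gamma> dual by (auto simp: wt_def dual_of_def algebra_simps)
  ultimately have "range wt \<subseteq> weights h"
    using y_wt weightsI by blast
  then have "finite (range wt)"
    using finite_weights[OF fin_dim] finite_subset by blast
  moreover have "inj wt"
  proof (rule injI)
    fix k l
    assume "wt k = wt l"
    then have "wt k t = wt l t"
      by simp
    then show "k = l"
      using \<beta>t by (simp add: wt_def)
  qed
  ultimately show False
    using finite_imageD infinite_UNIV_nat by blast
qed

lemma root_add_obtuse:
  assumes "\<beta> \<in> roots h" "\<gamma> \<in> roots h" "\<gamma> (dual_vector \<beta>) < 0"
  shows "\<beta> + \<gamma> \<in> roots h \<or> \<beta> + \<gamma> = 0"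
proof -
  obtain e where e: "e \<in> root_space h \<beta>" "e \<noteq> 0"
    using assms weightsE by (auto simp: roots_eq_weights)
  obtain x where x: "x \<in> root_space h \<gamma>" "x \<noteq> 0"
    using assms weightsE by (auto simp: roots_eq_weights)
  have "bracket e x \<noteq> 0"
    using bracket_nonzero[OF assms(1) e _ x assms(3)] assms by (simp add: roots_def)
  moreover have "\<beta> + \<gamma> \<in> dual_of h"
    using assms dual_of_add by (auto simp: roots_def)
  ultimately show ?thesis
    using weightsI bracket_root_space[OF e(1) x(1)] by (auto simp: roots_eq_weights)
qed

end

section \<open>Central root vectors of the nilradical\<close>

interpretation functionals: vector_space scale_fun
  by (rule vector_space_scale_fun)

text \<open>Over a dependent set \<open>representation\<close> defaults to zero, so a single nonzero
  coordinate certifies independence. The root \<gamma> of the theorem has such a coordinate.\<close>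

lemma coord_nonzero_independent:
  assumes "coord P \<alpha> \<gamma> \<noteq> 0"
  shows "functionals.independent (simple_roots P)"
  using assms by (auto simp: coord_def functionals.representation_def split: if_splits)

context lie_algebra
begin

lemma lie_idealD:
  assumes "lie_ideal I"
  shows "0 \<in> I" and "x \<in> I \<Longrightarrow> y \<in> I \<Longrightarrow> x + y \<in> I" and "x \<in> I \<Longrightarrow> y \<in> I \<Longrightarrow> x - y \<in> I"
    and "x \<in> I \<Longrightarrow> c *s x \<in> I" and "y \<in> I \<Longrightarrow> bracket x y \<in> I"
  using assms subspace_diff by (auto simp: lie_ideal_def subspace_def)

text \<open>The bracket lies one step further down the lower central series, in
  \<open>C\<^sup>k = 0\<close>; \<open>k \<ge> 1\<close> guards the subtraction.\<close>

lemma last_lower_central_centralized: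
  assumes "step_nilpotent k (parabolic_nilradical h P \<Pi>0)"
    and "X \<in> lower_central (parabolic_nilradical h P \<Pi>0) (k - 1)"
    and "\<beta> \<in> nilradical_roots P \<Pi>0" "z \<in> root_space h \<beta>"
  shows "bracket z X = 0"
proof -
  let ?N = "parabolic_nilradical h P \<Pi>0"
  have k: "Suc (k - 1) = k" and zero: "lower_central ?N k = {0}"
    using assms(1) by (auto simp: step_nilpotent_def)
  have "z \<in> ?N"
    unfolding parabolic_nilradical_def using assms by (intro span_base) blast
  then have "bracket z X \<in> lower_central ?N (Suc (k - 1))"
    using assms(2) by (auto simp: bracket_span_def intro!: span_base)
  then show ?thesis
    by (simp only: k zero singleton_iff)
qed

end

context split_simple_lie_algebra
begin

context
  fixes P :: "('g \<Rightarrow> 'k) set"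
  assumes positive: "positive_system (roots h) P"
begin

interpretation positive_root_pairing "roots h" P "\<lambda>f \<beta>. f (dual_vector \<beta>)"
proof
  have "roots h \<subseteq> weights h"
    by (auto simp: roots_eq_weights)
  then show "finite (roots h)"
    using finite_weights[OF fin_dim] finite_subset by blast
qed (simp_all add: uminus_roots dual_vector_sym dual_vector_pos root_add_obtuse positive)

lemma positive_in_span:
  assumes "\<gamma> \<in> P"
  shows "\<gamma> \<in> functionals.span (simple_roots P)"
  using assms
proof (induction \<gamma> rule: positive_induct)
  case (step \<gamma>)
  from step.hyps show ?case
  proof (cases rule: simple_or_sum)
    case 1
    then show ?thesis
      by (rule functionals.span_base)
  next
    case (2 \<beta> \<gamma>')
    then show ?thesis
      unfolding 2(3) using step.IH[of \<beta>] step.IH[of \<gamma>'] 2 by (intro functionals.span_add) auto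
  qed
qed

lemma root_in_span:
  assumes "\<gamma> \<in> roots h"
  shows "\<gamma> \<in> functionals.span (simple_roots P)"
  using P_total[OF assms] positive_in_span functionals.span_neg[of "- \<gamma>"] by auto

lemma weight_in_span:
  assumes "\<gamma> \<in> weights h"
  shows "\<gamma> \<in> functionals.span (simple_roots P)"
  using assms root_in_span functionals.span_zero by (cases "\<gamma> = 0") (auto simp: roots_eq_weights)

section \<open>Coordinates in the simple roots and the centralizer argument\<close>

context
  assumes indep: "functionals.independent (simple_roots P)"
begin

lemma coord_add:
  assumes "\<beta> \<in> functionals.span (simple_roots P)" "\<gamma> \<in> functionals.span (simple_roots P)"
  shows "coord P \<sigma> (\<beta> + \<gamma>) = coord P \<sigma> \<beta> + coord P \<sigma> \<gamma>"
  using functionals.representation_add[OF indep assms(2,1)] by (simp add: coord_def)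

lemma coord_uminus:
  assumes "\<gamma> \<in> functionals.span (simple_roots P)"
  shows "coord P \<sigma> (- \<gamma>) = - coord P \<sigma> \<gamma>"
  using functionals.representation_neg[OF indep assms] by (simp add: coord_def)

lemma coord_zero: "coord P \<sigma> 0 = 0"
  by (simp add: coord_def functionals.representation_zero)

lemma coord_simple:
  assumes "\<sigma>' \<in> simple_roots P"
  shows "coord P \<sigma> \<sigma>' = (if \<sigma> = \<sigma>' then 1 else 0)"
  using functionals.representation_basis[OF indep assms] by (simp add: coord_def)

lemma coord_nonneg:
  assumes "\<gamma> \<in> P"
  shows "coord P \<sigma> \<gamma> \<ge> 0"
  using assms
proof (induction \<gamma> rule: positive_induct)
  case (step \<gamma>)
  from step.hyps show ?case
  proof (cases rule: simple_or_sum)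
    case 1
    then show ?thesis
      by (simp add: coord_simple)
  next
    case (2 \<beta> \<gamma>')
    then show ?thesis
      unfolding 2(3) coord_add[OF positive_in_span[OF 2(1)] positive_in_span[OF 2(2)]]
      using step.IH[of \<beta>] step.IH[of \<gamma>'] 2 by (intro add_nonneg_nonneg) auto
  qed
qed

lemma coord_pos_imp_positive:
  assumes "\<gamma> \<in> weights h" "coord P \<sigma> \<gamma> > 0"
  shows "\<gamma> \<in> P"
proof -
  have "\<gamma> \<in> roots h"
    using assms coord_zero by (auto simp: roots_eq_weights)
  then show ?thesis
    using P_total[of \<gamma>] coord_nonneg[of "- \<gamma>" \<sigma>] coord_uminus[OF root_in_span, of \<gamma> \<sigma>] assms(2)
    by auto
qed

text \<open>If \<open>coord P \<alpha> \<gamma> = 0\<close>, then by invariance of the Killing form \<open>X\<close> commutes not only with the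
  root spaces on which \<open>coord P \<alpha>\<close> is positive but also with those on which it is negative. The
  centralizer of all these root spaces is an ideal.\<close>

lemma central_root_coord_nonzero:
  assumes \<Pi>0: "\<Pi>0 \<subseteq> simple_roots P" and \<alpha>: "\<alpha> \<in> \<Pi>0" and \<gamma>: "\<gamma> \<in> P"
    and X: "X \<in> root_space h \<gamma>" "X \<noteq> 0"
    and central: "\<And>\<beta> z. \<beta> \<in> nilradical_roots P \<Pi>0 \<Longrightarrow> z \<in> root_space h \<beta> \<Longrightarrow> bracket z X = 0"
  shows "coord P \<alpha> \<gamma> \<noteq> 0"
proof
  assume zero: "coord P \<alpha> \<gamma> = 0"
  define c where "c = coord P \<alpha>"
  \<comment> \<open>\<open>c\<close> is additive on \<open>D\<close>, which contains all weights and
    also sums such as \<mu> + \<gamma> that are not known to be weights.\<close>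
  define D where "D = dual_of h \<inter> functionals.span (simple_roots P)"
  have D_weight: "\<mu> \<in> D" if "\<mu> \<in> weights h" for \<mu>
    using that weight_in_span by (auto simp: D_def weights_def)
  have D_add: "\<beta> + \<mu> \<in> D" and c_add: "c (\<beta> + \<mu>) = c \<beta> + c \<mu>" if "\<beta> \<in> D" "\<mu> \<in> D" for \<beta> \<mu>
    using that by (auto simp: D_def c_def dual_of_add functionals.span_add coord_add)
  have D_uminus: "- \<mu> \<in> D" and c_uminus: "c (- \<mu>) = - c \<mu>" if "\<mu> \<in> D" for \<mu>
    using that by (auto simp: D_def c_def dual_of_uminus functionals.span_neg coord_uminus)
  have \<gamma>_D: "\<gamma> \<in> D"
    using \<gamma> P_subset D_weight by (auto simp: roots_eq_weights)
  have pos: "bracket z X = 0" if "\<mu> \<in> D" "c \<mu> > 0" "z \<in> root_space h \<mu>" for \<mu> z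
  proof (cases "z = 0")
    case False
    then have "\<mu> \<in> P"
      using that weightsI coord_pos_imp_positive by (auto simp: c_def D_def)
    then have "\<mu> \<in> nilradical_roots P \<Pi>0"
      using that \<alpha> by (auto simp: nilradical_roots_def c_def intro!: bexI[of _ \<alpha>])
    then show ?thesis
      using central that by blast
  qed simp
  \<comment> \<open>A nonzero bracket would pair to 1 with some \<open>y\<close> of weight - (\<mu>
    + \<gamma>). Since \<open>c \<gamma> = 0\<close>, that weight has positive \<open>c\<close>, so
    \<open>y\<close> commutes with \<open>X\<close> and invariance makes the pairing zero.\<close>
  have neg: "bracket z X = 0" if \<mu>: "\<mu> \<in> D" "c \<mu> < 0" "z \<in> root_space h \<mu>" for \<mu> z
  proof (rule ccontr)
    assume nz: "bracket z X \<noteq> 0"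
    have sum: "\<mu> + \<gamma> \<in> D"
      using D_add \<mu> \<gamma>_D by blast
    have "bracket z X \<in> root_space h (\<mu> + \<gamma>)"
      using bracket_root_space \<mu> X by blast
    then obtain y where y: "y \<in> root_space h (- (\<mu> + \<gamma>))" "killing (bracket z X) y = 1"
      using killing_pairing[OF _ _ nz] sum unfolding D_def by blast
    have "c (- (\<mu> + \<gamma>)) > 0"
      using \<mu> \<gamma>_D zero c_uminus[OF sum] c_add[OF \<mu>(1) \<gamma>_D] by (simp add: c_def)
    then have "bracket y X = 0"
      using pos y D_uminus[OF sum] by blast
    then have "bracket X y = 0"
      using bracket_anticommute[of X y] by simp
    then show False
      using y(2) by (simp add: killing_invariant)
  qed
  define M where "M = {m. \<forall>\<mu>\<in>D. c \<mu> \<noteq> 0 \<longrightarrow> (\<forall>z\<in>root_space h \<mu>. bracket z m = 0)}"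
  have X_M: "X \<in> M"
    using pos neg by (auto simp: M_def neq_iff)
  have M_sub: "subspace M"
    by (auto simp: subspace_def M_def bracket_add_right bracket_scale_right)
  have "bracket y m \<in> M" if m: "m \<in> M" for y m
  proof (induction y rule: weight_vector_induct)
    case (weight \<beta> y)
    show ?case
    proof (cases "y = 0 \<or> bracket y m = 0")
      case True
      then show ?thesis
        using subspace_0[OF M_sub] by auto
    next
      case False
      then have \<beta>: "\<beta> \<in> D"
        using D_weight weight weightsI by blast
      \<comment> \<open>If \<open>c \<beta>\<close> were nonzero, \<open>y\<close> itself would
        annihilate \<open>m\<close>. With \<open>c \<beta> = 0\<close>, the bracket of
        \<open>z\<close> and \<open>y\<close> keeps the nonzero \<open>c\<close> of
        \<open>z\<close>, so both terms of the derivation rule vanish.\<close>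
      then have c\<beta>: "c \<beta> = 0"
        using m weight False unfolding M_def by blast
      have "bracket z (bracket y m) = 0" if "\<mu> \<in> D" "c \<mu> \<noteq> 0" "z \<in> root_space h \<mu>" for \<mu> z
      proof -
        have "bracket z m = 0"
          using m that by (auto simp: M_def)
        moreover have "bracket (bracket z y) m = 0"
          using m bracket_root_space[OF that(3) weight(2)] D_add[OF that(1) \<beta>]
            c_add[OF that(1) \<beta>] c\<beta> that(2)
          by (auto simp: M_def)
        ultimately show ?thesis
          by (simp add: bracket_derivation[of z])
      qed
      then show ?thesis
        by (simp add: M_def)
    qed
  qed (simp_all add: bracket_add_left subspace_0[OF M_sub] subspace_add[OF M_sub])
  then have "lie_ideal M"
    using M_sub by (simp add: lie_ideal_def)
  then have UNIV: "M = UNIV"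
    using simple X X_M by (auto simp: simple_def)
  have \<alpha>P: "\<alpha> \<in> simple_roots P" "\<alpha> \<in> P"
    using \<alpha> \<Pi>0 by (auto simp: simple_roots_def)
  then have \<alpha>R: "\<alpha> \<in> roots h"
    using P_subset by blast
  then obtain e where e: "e \<in> root_space h \<alpha>" "e \<noteq> 0"
    using weightsE by (auto simp: roots_eq_weights)
  have "c \<alpha> \<noteq> 0" "\<alpha> \<in> D"
    using \<alpha>R \<alpha>P D_weight by (auto simp: c_def coord_simple roots_eq_weights)
  then have "bracket e m = 0" for m
    using UNIV e by (auto simp: M_def)
  \<comment> \<open>The contradiction: \<open>bracket (dual_vector \<alpha>) e\<close> is also
    \<open>e\<close> times a positive scalar.\<close>
  then have "bracket (dual_vector \<alpha>) e = 0"
    using bracket_anticommute[of _ e] by simp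
  then show False
    using e dual_vector(1)[OF \<alpha>R] dual_vector_pos[OF \<alpha>R] by (simp add: root_space_def)
qed

end

text \<open>The staircase with \<open>a\<close> and \<open>b\<close> the coordinates at \<alpha> and
  at a second root \<alpha>' of \<open>\<Pi>0\<close>: \<delta> has no \<alpha>, so \<alpha>' keeps
  it in the nilradical.\<close>

lemma central_root_staircase:
  assumes \<Pi>0: "\<Pi>0 \<subseteq> simple_roots P" "card \<Pi>0 \<ge> 2" and \<gamma>: "\<gamma> \<in> nilradical_roots P \<Pi>0"
    and X: "X \<in> root_space h \<gamma>" "X \<noteq> 0"
    and central: "\<And>\<beta> z. \<beta> \<in> nilradical_roots P \<Pi>0 \<Longrightarrow> z \<in> root_space h \<beta> \<Longrightarrow> bracket z X = 0"
    and \<alpha>: "\<alpha> \<in> \<Pi>0"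
  shows "\<exists>(t::nat) \<delta> (\<beta> :: nat \<Rightarrow> 'g \<Rightarrow> 'k).
           t \<ge> 1 \<and>
           \<delta> \<in> nilradical_roots P \<Pi>0 \<and>
           (\<forall>j\<in>{1..t}. \<beta> j \<in> nilradical_roots P \<Pi>0) \<and>
           \<gamma> = \<delta> + (\<Sum>j\<in>{1..t}. \<beta> j) \<and>
           coord P \<alpha> \<delta> = 0 \<and>
           (\<forall>j\<in>{1..t}. coord P \<alpha> (\<beta> j) \<noteq> 0) \<and>
           (\<forall>s\<in>{0..t - 1}. \<delta> + (\<Sum>j\<in>{t - s..t}. \<beta> j) \<in> nilradical_roots P \<Pi>0)"
proof -
  have indep: "functionals.independent (simple_roots P)"
    using \<gamma> coord_nonzero_independent by (auto simp: nilradical_roots_def)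
  have \<gamma>P: "\<gamma> \<in> P"
    using \<gamma> by (simp add: nilradical_roots_def)
  obtain \<alpha>' where \<alpha>': "\<alpha>' \<in> \<Pi>0" "\<alpha>' \<noteq> \<alpha>"
    using \<Pi>0(2) \<alpha> by (metis card_le_Suc0_iff_eq card.infinite not_less_eq_eq numeral_2_eq_2 zero_le)
  have nz: "coord P \<sigma> \<gamma> \<noteq> 0" if "\<sigma> \<in> \<Pi>0" for \<sigma>
    using central_root_coord_nonzero[OF indep \<Pi>0(1) that \<gamma>P X central] .
  have "\<exists>(t::nat) \<delta> \<beta>. t \<ge> 1 \<and> \<delta> \<in> P \<and> coord P \<alpha> \<delta> = 0 \<and> coord P \<alpha>' \<delta> \<noteq> 0 \<and>
      (\<forall>j\<in>{1..t}. \<beta> j \<in> P \<and> coord P \<alpha> (\<beta> j) \<noteq> 0) \<and> \<gamma> = \<delta> + (\<Sum>j\<in>{1..t}. \<beta> j) \<and>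
      (\<forall>s\<in>{0..t - 1}. \<delta> + (\<Sum>j\<in>{t - s..t}. \<beta> j) \<in> P \<and>
        coord P \<alpha>' (\<delta> + (\<Sum>j\<in>{t - s..t}. \<beta> j)) \<noteq> 0)"
  proof (rule staircase)
    fix \<sigma>
    assume "\<sigma> \<in> simple_roots P"
    then show "coord P \<alpha> \<sigma> = 0 \<or> coord P \<alpha>' \<sigma> = 0"
      using coord_simple[OF indep] \<alpha>'(2) by auto
  qed (rule coord_add[OF indep] coord_nonneg[OF indep] positive_in_span \<gamma>P nz \<alpha> \<alpha>' | assumption)+
  then obtain t :: nat and \<delta> \<beta> where t: "t \<ge> 1"
    and \<delta>: "\<delta> \<in> P" "coord P \<alpha> \<delta> = 0" "coord P \<alpha>' \<delta> \<noteq> 0"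
    and \<beta>: "\<forall>j\<in>{1..t}. \<beta> j \<in> P \<and> coord P \<alpha> (\<beta> j) \<noteq> 0"
    and sum: "\<gamma> = \<delta> + (\<Sum>j\<in>{1..t}. \<beta> j)"
    and partial: "\<forall>s\<in>{0..t - 1}. \<delta> + (\<Sum>j\<in>{t - s..t}. \<beta> j) \<in> P \<and>
      coord P \<alpha>' (\<delta> + (\<Sum>j\<in>{t - s..t}. \<beta> j)) \<noteq> 0"
    by blast
  have "\<delta> \<in> nilradical_roots P \<Pi>0"
    using \<delta> \<alpha>' by (auto simp: nilradical_roots_def)
  moreover have "\<forall>j\<in>{1..t}. \<beta> j \<in> nilradical_roots P \<Pi>0"
    using \<beta> \<alpha> by (auto simp: nilradical_roots_def)
  moreover have "\<forall>s\<in>{0..t - 1}. \<delta> + (\<Sum>j\<in>{t - s..t}. \<beta> j) \<in> nilradical_roots P \<Pi>0"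
    using partial \<alpha>' unfolding nilradical_roots_def by blast
  ultimately show ?thesis
    using t \<delta>(2) \<beta> sum by blast
qed

end

end

section \<open>Split real forms\<close>

text \<open>Simplicity descends from the complexification: a real ideal \<open>I\<close> gives the
  complex ideal \<open>I \<times> I\<close>, which stands for \<open>I + \<i> I\<close>, and a
  nonzero complex bracket involves a nonzero real one.\<close>

lemma split_simple_lie_algebraI:
  fixes br :: "'g::real_vector \<Rightarrow> 'g \<Rightarrow> 'g"
  assumes "split_real_form br h"
  shows "split_simple_lie_algebra scaleR br h"
proof -
  interpret L: lie_algebra scaleR br
    using assms by (simp add: split_real_form_def)
  interpret C: lie_algebra complex_scale "complex_bracket br"
    by (rule lie_algebra_complexification) (rule L.lie_algebra_axioms)
  have simple: "C.simple"
    using assms by (simp add: split_real_form_def)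
  have "L.simple"
    unfolding L.simple_def
  proof (intro conjI allI impI)
    obtain x1 x2 y1 y2 where *: "complex_bracket br (x1, x2) (y1, y2) \<noteq> 0"
      using simple by (auto simp: C.simple_def)
    show "\<exists>x y. br x y \<noteq> 0"
    proof (rule ccontr)
      assume "\<not> ?thesis"
      then have "br x y = 0" for x y
        by blast
      then show False
        using * by (simp add: complex_bracket_def zero_prod_def)
    qed
    fix I
    assume "L.lie_ideal I"
    note I = L.lie_idealD[OF this]
    have "C.lie_ideal (I \<times> I)"
      unfolding C.lie_ideal_def C.subspace_def
      using I by (auto simp: complex_scale_def complex_bracket_def zero_prod_def)
    then have "I \<times> I = {0} \<or> I \<times> I = UNIV"
      using simple by (auto simp: C.simple_def)
    then show "I = {0} \<or> I = UNIV"
      using I(1) by (auto simp: zero_prod_def set_eq_iff)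
  qed
  then show ?thesis
    using assms L.lie_algebra_axioms
    by (simp add: split_simple_lie_algebra_def split_simple_lie_algebra_axioms_def split_real_form_def)
qed

theorem proposition4p2:
  fixes br :: "'g::real_vector \<Rightarrow> 'g \<Rightarrow> 'g"
    and h \<nn> :: "'g set"
    and P \<Pi>0 :: "('g \<Rightarrow> real) set"
    and k :: nat
    and \<gamma> :: "'g \<Rightarrow> real"
    and X :: 'g
  assumes split: "split_real_form br h"
    and positive: "positive_system (lie_algebra.roots scaleR br h) P"
    and subset: "\<Pi>0 \<subseteq> simple_roots P"
    and card: "card \<Pi>0 \<ge> 2"
    and nilradical: "\<nn> = lie_algebra.parabolic_nilradical scaleR br h P \<Pi>0"
    and step: "lie_algebra.step_nilpotent scaleR br k \<nn>"
    and gamma: "\<gamma> \<in> nilradical_roots P \<Pi>0"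
    and X: "X \<in> lie_algebra.root_space scaleR br h \<gamma>" "X \<noteq> 0"
    and X_in: "X \<in> lie_algebra.lower_central scaleR br \<nn> (k - 1)"
  shows "\<forall>\<alpha>\<in>\<Pi>0. \<exists>(t::nat) \<delta> (\<beta> :: nat \<Rightarrow> 'g \<Rightarrow> real).
           t \<ge> 1 \<and>
           \<delta> \<in> nilradical_roots P \<Pi>0 \<and>
           (\<forall>j\<in>{1..t}. \<beta> j \<in> nilradical_roots P \<Pi>0) \<and>
           \<gamma> = \<delta> + (\<Sum>j\<in>{1..t}. \<beta> j) \<and>
           coord P \<alpha> \<delta> = 0 \<and>
           (\<forall>j\<in>{1..t}. coord P \<alpha> (\<beta> j) \<noteq> 0) \<and>
           (\<forall>s\<in>{0..t - 1}. \<delta> + (\<Sum>j\<in>{t - s..t}. \<beta> j) \<in> nilradical_roots P \<Pi>0)"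
proof -
  interpret L: split_simple_lie_algebra scaleR br h
    by (rule split_simple_lie_algebraI[OF split])
  have "br z X = 0" if "\<beta> \<in> nilradical_roots P \<Pi>0" "z \<in> L.root_space h \<beta>" for \<beta> z
    using L.last_lower_central_centralized that step X_in unfolding nilradical by blast
  then show ?thesis
    by (intro ballI L.central_root_staircase[OF positive subset card gamma X])
qed

end
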